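(* Let $\{s_k\}_{k\ge0}$ be a strictly positive sequence and $(L,\omega,\upsilon)$ the corresponding Krein--Langer string, with coefficients $l_j,\omega_j,\upsilon_j$ ($j\ge0$) defined by $l_j = \frac{\Delta_{1,k(j)}^2}{\Delta_{0,k(j)-1}\Delta_{0,k(j)}}$; $\omega_j=\frac{\Delta_{0,k(j)}^2}{\Delta_{1,k(j)}\Delta_{1,k(j)+1}}$, $\upsilon_j=0$ if $k(j+1)-k(j)=1$; $\omega_j=\frac{\Delta_{-1,k(j)}}{\Delta_{1,k(j)}}-\frac{\Delta_{-1,k(j+1)}}{\Delta_{1,k(j+1)}}$, $\upsilon_j=\frac{\Delta_{-1,k(j)+1}^2}{\Delta_{0,k(j)}\Delta_{0,k(j)+1}}$ if $k(j+1)-k(j)=2$; $x_j=\sum_{i\le j}l_i$, $L=\sum_i l_i$, $\omega=\sum_j\omega_j\delta_{x_j}$, $\upsilon=\sum_j\upsilon_j\delta_{x_j}$. The following are equivalent: (i) The Hamburger moment problem $s_k=\int_{\mathbb R}\lambda^k\rho(d\lambda)$, $k\ge0$, has exactly one solution $\rho$ among positive Borel measures on $\mathbb R$ (it is determinate). (ii) The string $(L,\omega,\upsilon)$ is singular, i.e. $L+\int_0^L\mathsf w(x)^2dx+\upsilon([0,L))=\infty$, where $\mathsf w(x):=\omega([0,x))$. (iii) $\displaystyle\sum_{n\ge0}\big(l_{n+1}+l_{n+1}\mathsf w_n^2+\upsilon_n\big)=\infty$, where $\mathsf w_n:=\sum_{k=0}^n\omega_k$.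
   Context: A real sequence $\{s_k\}_{k\ge0}$ is strictly positive if $\Delta_{0,n}:=\det(s_{i+j})_{i,j=0}^{n}>0$ for all $n\ge0$; $\Delta_{0,-1}:=1$. $\Delta_{1,0}:=1$, $\Delta_{1,n}:=\det(s_{i+j+1})_{i,j=0}^{n-1}$ ($n\ge1$); $\Delta_{-1,0}:=0$, $\Delta_{-1,n}:=\det(s_{i+j-1})_{i,j=0}^{n}$ with $s_{-1}:=0$ ($n\ge1$). For $j\ge0$, $k(j)$ is the largest integer $k\ge0$ such that exactly $j$ of $\Delta_{1,0},\dots,\Delta_{1,k-1}$ are nonzero. By Hamburger's theorem, a solution of the moment problem exists for positive sequences. *)

theory Defs
  imports "HOL-Analysis.Analysis" "Jordan_Normal_Form.Determinant"
begin

definition hankel_det :: "(nat \<Rightarrow> real) \<Rightarrow> nat \<Rightarrow> real" where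
  "hankel_det t m = Determinant.det (mat m m (\<lambda>(i, j). t (i + j)))"

definition Delta0 :: "(nat \<Rightarrow> real) \<Rightarrow> int \<Rightarrow> real" where
  "Delta0 s n = (if n < 0 then 1 else hankel_det s (nat n + 1))"

definition Delta1 :: "(nat \<Rightarrow> real) \<Rightarrow> nat \<Rightarrow> real" where
  "Delta1 s n = (if n = 0 then 1 else hankel_det (\<lambda>m. s (m + 1)) n)"

text \<open>Delta_{-1,0} = 0, Delta_{-1,n} = det (s_{i+j-1})_{i,j=0..n} with s_{-1} = 0, n >= 1.\<close>
definition Deltam1 :: "(nat \<Rightarrow> real) \<Rightarrow> nat \<Rightarrow> real" where
  "Deltam1 s n = (if n = 0 then 0
     else hankel_det (\<lambda>m. if m = 0 then 0 else s (m - 1)) (n + 1))"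

definition strictly_positive :: "(nat \<Rightarrow> real) \<Rightarrow> bool" where
  "strictly_positive s \<longleftrightarrow> (\<forall>n::nat. Delta0 s (int n) > 0)"

definition kidx :: "(nat \<Rightarrow> real) \<Rightarrow> nat \<Rightarrow> nat" where
  "kidx s j = (GREATEST k. card {i. i < k \<and> Delta1 s i \<noteq> 0} = j)"

definition string_l :: "(nat \<Rightarrow> real) \<Rightarrow> nat \<Rightarrow> real" where
  "string_l s j = (Delta1 s (kidx s j))\<^sup>2 /
      (Delta0 s (int (kidx s j) - 1) * Delta0 s (int (kidx s j)))"

text \<open>The paper defines omega_j, upsilon_j in the two cases k(j+1)-k(j) = 1 and = 2
  (the only possible ones); the second formula is used whenever the gap is not 1.\<close>
definition string_omega :: "(nat \<Rightarrow> real) \<Rightarrow> nat \<Rightarrow> real" where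
  "string_omega s j =
     (if kidx s (Suc j) - kidx s j = 1
      then (Delta0 s (int (kidx s j)))\<^sup>2 /
             (Delta1 s (kidx s j) * Delta1 s (kidx s j + 1))
      else Deltam1 s (kidx s j) / Delta1 s (kidx s j)
             - Deltam1 s (kidx s (Suc j)) / Delta1 s (kidx s (Suc j)))"

definition string_upsilon :: "(nat \<Rightarrow> real) \<Rightarrow> nat \<Rightarrow> real" where
  "string_upsilon s j =
     (if kidx s (Suc j) - kidx s j = 1 then 0
      else (Deltam1 s (kidx s j + 1))\<^sup>2 /
             (Delta0 s (int (kidx s j)) * Delta0 s (int (kidx s j) + 1)))"

definition string_x :: "(nat \<Rightarrow> real) \<Rightarrow> nat \<Rightarrow> real" where
  "string_x s j = (\<Sum>i\<le>j. string_l s i)"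

definition string_L :: "(nat \<Rightarrow> real) \<Rightarrow> ennreal" where
  "string_L s = (\<Sum>i. ennreal (string_l s i))"

text \<open>w(x) = omega([0,x)) where omega = sum_j omega_j delta_{x_j}.\<close>
definition string_w :: "(nat \<Rightarrow> real) \<Rightarrow> real \<Rightarrow> real" where
  "string_w s x = (\<Sum>j\<in>{j. 0 \<le> string_x s j \<and> string_x s j < x}. string_omega s j)"

text \<open>upsilon([0,L)) where upsilon = sum_j upsilon_j delta_{x_j}.\<close>
definition string_upsilon_mass :: "(nat \<Rightarrow> real) \<Rightarrow> ennreal" where
  "string_upsilon_mass s =
     (\<Sum>j. if 0 \<le> string_x s j \<and> ennreal (string_x s j) < string_L s
          then ennreal (string_upsilon s j) else 0)"

definition string_singular :: "(nat \<Rightarrow> real) \<Rightarrow> bool" where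
  "string_singular s \<longleftrightarrow>
     string_L s
     + (\<integral>\<^sup>+ x. indicator {x. 0 \<le> x \<and> ennreal x < string_L s} x
                 * ennreal ((string_w s x)\<^sup>2) \<partial>lborel)
     + string_upsilon_mass s = \<infinity>"

definition moment_solution :: "(nat \<Rightarrow> real) \<Rightarrow> real measure \<Rightarrow> bool" where
  "moment_solution s \<rho> \<longleftrightarrow> sets \<rho> = sets borel \<and>
     (\<forall>k. has_bochner_integral \<rho> (\<lambda>t. t ^ k) (s k))"

definition moment_determinate :: "(nat \<Rightarrow> real) \<Rightarrow> bool" where
  "moment_determinate s \<longleftrightarrow> (\<exists>!\<rho>. moment_solution s \<rho>)"

end

theory Submission
  imports Defs
    "HOL-Computational_Algebra.Fundamental_Theorem_Algebra"
    "HOL-Probability.Helly_Selection"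
    "HOL-Probability.Probability_Mass_Function"
    "HOL-Real_Asymp.Real_Asymp"
begin

text \<open>
  Let \<open>P\<^sub>n\<close> be the orthonormal polynomials of \<open>s\<close> and \<open>Q\<^sub>n\<close> the second-kind ones. Cofactor
  expansion gives \<open>P\<^sub>n(0)\<^sup>2 = \<Delta>\<^sub>1\<^sub>,\<^sub>n\<^sup>2 / (\<Delta>\<^sub>0\<^sub>,\<^sub>n\<^sub>-\<^sub>1 \<Delta>\<^sub>0\<^sub>,\<^sub>n)\<close> and the same for \<open>Q\<^sub>n(0)\<close> with
  \<open>\<Delta>\<^sub>-\<^sub>1\<^sub>,\<^sub>n\<close>, and constancy of the Casoratian of \<open>P(0)\<close> and \<open>Q(0)\<close> makes the sums of the \<open>\<omega>\<^sub>j\<close>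
  telescope to \<open>- \<Delta>\<^sub>-\<^sub>1 / \<Delta>\<^sub>1\<close>. So the partial sums of the series in (iii) are those of
  \<open>P\<^sub>n(0)\<^sup>2 + Q\<^sub>n(0)\<^sup>2\<close> over \<open>1 \<le> n \<le> k(m)\<close>, and what remains is Hamburger's criterion:
  determinacy holds iff this series diverges. If it converges, variation of constants makes
  \<open>P\<^sub>n(x)\<close> square summable for every real \<open>x\<close>, so subtracting a small point mass at \<open>x\<close> keeps the
  moment functional positive, and there is a solution with an atom at \<open>x\<close>; a unique solution
  would have uncountably many atoms. Conversely, two different solutions have different Cauchy
  transforms at some non-real \<open>z\<close>; by Bessel's inequality the Fourier coefficients of \<open>1 / (t - z)\<close>
  in both spaces are square summable, they are independent solutions of the three-term
  recurrence at \<open>z\<close>, and variation of constants carries square summability from \<open>z\<close> to \<open>0\<close>.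
\<close>

hide_const (open) Module.smult

section \<open>Square summable solutions of three-term recurrences\<close>

text \<open>Row 0 is left out on purpose: for nonvanishing \<open>b\<close> the solution space then
  has dimension two, and it admits the second-kind values and the Cauchy integrals, which violate
  row 0.\<close>

definition jacobi_solution ::
    "(nat \<Rightarrow> 'a::field) \<Rightarrow> (nat \<Rightarrow> 'a) \<Rightarrow> 'a \<Rightarrow> (nat \<Rightarrow> 'a) \<Rightarrow> bool" where
  "jacobi_solution a b z u \<longleftrightarrow>
     (\<forall>n. b (Suc n) * u (Suc (Suc n)) + a (Suc n) * u (Suc n) + b n * u n = z * u (Suc n))"

text \<open>The discrete Wronskian; the weight \<open>b n\<close> makes it independent of
  \<open>n\<close> for two solutions with the same parameter.\<close>

definition casoratian :: "(nat \<Rightarrow> 'a::field) \<Rightarrow> (nat \<Rightarrow> 'a) \<Rightarrow> (nat \<Rightarrow> 'a) \<Rightarrow> nat \<Rightarrow> 'a" where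
  "casoratian b u v n = b n * (u (Suc n) * v n - u n * v (Suc n))"

text \<open>Discrete Lagrange identity: inserting the recurrence for the newest terms cancels the
  diagonal coefficients and leaves only the difference of the parameters.\<close>

lemma casoratian_Suc:
  assumes "jacobi_solution a b z u" "jacobi_solution a b w v"
  shows "casoratian b u v (Suc n) = casoratian b u v n + (z - w) * u (Suc n) * v (Suc n)"
proof -
  have eqs: "b (Suc n) * u (Suc (Suc n)) = z * u (Suc n) - a (Suc n) * u (Suc n) - b n * u n"
       "b (Suc n) * v (Suc (Suc n)) = w * v (Suc n) - a (Suc n) * v (Suc n) - b n * v n"
    using assms unfolding jacobi_solution_def by (auto simp: algebra_simps)
  have "casoratian b u v (Suc n) = (b (Suc n) * u (Suc (Suc n))) * v (Suc n)
      - u (Suc n) * (b (Suc n) * v (Suc (Suc n)))"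
    by (simp add: casoratian_def algebra_simps)
  thus ?thesis
    unfolding eqs by (simp add: casoratian_def algebra_simps)
qed

lemma casoratian_const:
  assumes "jacobi_solution a b z u" "jacobi_solution a b z v"
  shows "casoratian b u v n = casoratian b u v 0"
  by (induction n) (use casoratian_Suc[OF assms] in auto)

text \<open>Uses 1 + x \<le> exp x factor by factor; it controls the growth factors accumulated in
  the Gronwall argument below.\<close>

lemma prod_one_plus_bounded:
  fixes f :: "nat \<Rightarrow> real"
  assumes "\<And>n. f n \<ge> 0" "summable f"
  shows "(\<Prod>k<n. 1 + f k) \<le> exp (suminf f)"
proof -
  have "(\<Prod>k<n. 1 + f k) \<le> (\<Prod>k<n. exp (f k))"
    using assms by (intro prod_mono) (auto simp: add_nonneg_nonneg)
  also have "\<dots> = exp (\<Sum>k<n. f k)" by (simp add: exp_sum)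
  also have "\<dots> \<le> exp (suminf f)"
    using assms by (simp add: sum_le_suminf)
  finally show ?thesis .
qed

lemma summable_square_add:
  fixes f g :: "nat \<Rightarrow> real"
  assumes "summable (\<lambda>n. (f n)\<^sup>2)" "summable (\<lambda>n. (g n)\<^sup>2)"
  shows "summable (\<lambda>n. (f n + g n)\<^sup>2)"
proof (rule summable_comparison_test')
  show "summable (\<lambda>n. 2 * ((f n)\<^sup>2 + (g n)\<^sup>2))"
    using assms by (intro summable_mult summable_add)
  have "(f n + g n)\<^sup>2 \<le> 2 * ((f n)\<^sup>2 + (g n)\<^sup>2)" for n
    using sum_squares_bound[of "f n" "g n"] by (simp add: power2_sum algebra_simps)
  thus "norm ((f n + g n)\<^sup>2) \<le> 2 * ((f n)\<^sup>2 + (g n)\<^sup>2)" for n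
    by simp
qed

text \<open>Variation of constants: a solution at \<open>w\<close> is a combination of the two solutions at \<open>z\<close>
  whose coefficients are Casoratians; these stay bounded by a discrete Gronwall argument.\<close>
theorem square_summable_jacobi_solution:
  fixes u v y :: "nat \<Rightarrow> 'a::real_normed_field"
  assumes u: "jacobi_solution a b z u" and v: "jacobi_solution a b z v"
    and y: "jacobi_solution a b w y"
    and W: "casoratian b u v 0 \<noteq> 0"
    and su: "summable (\<lambda>n. (norm (u n))\<^sup>2)" and sv: "summable (\<lambda>n. (norm (v n))\<^sup>2)"
  shows "summable (\<lambda>n. (norm (y n))\<^sup>2)"
proof -
  define W where "W = casoratian b u v 0"
  \<comment> \<open>Cramer's rule: with these coefficients the combination of \<open>u\<close> and
    \<open>v\<close> agrees with \<open>y\<close> at the sites \<open>n\<close> and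
    \<open>Suc n\<close>.\<close>
  define A where "A n = casoratian b y v n / W" for n
  define B where "B n = - casoratian b y u n / W" for n
  define M where "M n = norm (A n) + norm (B n)" for n
  define g where "g n = norm (u n) + norm (v n)" for n
  define \<kappa> where "\<kappa> = norm (w - z) / norm W"
  have "W \<noteq> 0" using W by (simp add: W_def)
  have Wn: "b n * (u (Suc n) * v n - u n * v (Suc n)) = W" for n
    using casoratian_const[OF u v, of n] by (simp add: casoratian_def W_def)
  have yeq: "y (Suc n) = A n * u (Suc n) + B n * v (Suc n)" for n
  proof -
    have "W * (A n * u (Suc n) + B n * v (Suc n)) =
        casoratian b y v n * u (Suc n) - casoratian b y u n * v (Suc n)"
      using \<open>W \<noteq> 0\<close> by (simp add: A_def B_def field_simps)
    also have "\<dots> = y (Suc n) * (b n * (u (Suc n) * v n - u n * v (Suc n)))"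
      by (simp add: casoratian_def algebra_simps)
    also have "\<dots> = W * y (Suc n)" by (simp add: Wn)
    finally show ?thesis using \<open>W \<noteq> 0\<close> by simp
  qed
  have ynorm: "norm (y (Suc n)) \<le> M n * g (Suc n)" for n
  proof -
    have "norm (y (Suc n)) \<le> norm (A n) * norm (u (Suc n)) + norm (B n) * norm (v (Suc n))"
      unfolding yeq by (metis norm_triangle_ineq norm_mult)
    also have "\<dots> \<le> M n * g (Suc n)"
      by (simp add: M_def g_def algebra_simps)
    finally show ?thesis .
  qed
  have g0: "g n \<ge> 0" for n by (simp add: g_def)
  have M0: "M n \<ge> 0" for n by (simp add: M_def)
  have k0: "\<kappa> \<ge> 0" by (simp add: \<kappa>_def)
  \<comment> \<open>The coefficients change by multiples of \<open>(w - z) * y (Suc n)\<close>;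
    bounding \<open>y\<close> through \<open>ynorm\<close> makes the increment proportional to
    \<open>M n\<close> itself.\<close>
  have step: "M (Suc n) \<le> M n * (1 + \<kappa> * (g (Suc n))\<^sup>2)" for n
  proof -
    have "A (Suc n) = A n + (w - z) * y (Suc n) * v (Suc n) / W"
      by (simp add: A_def casoratian_Suc[OF y v] add_divide_distrib)
    hence 1: "norm (A (Suc n)) \<le> norm (A n) + \<kappa> * norm (y (Suc n)) * norm (v (Suc n))"
      by (metis (no_types, lifting) \<kappa>_def norm_triangle_ineq norm_mult norm_divide times_divide_eq_left)
    have "B (Suc n) = B n - (w - z) * y (Suc n) * u (Suc n) / W"
      by (simp add: B_def casoratian_Suc[OF y u] diff_divide_distrib)
    hence 2: "norm (B (Suc n)) \<le> norm (B n) + \<kappa> * norm (y (Suc n)) * norm (u (Suc n))"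
      by (metis (no_types, lifting) \<kappa>_def norm_triangle_ineq4 norm_mult norm_divide times_divide_eq_left)
    have "M (Suc n) \<le> M n + \<kappa> * norm (y (Suc n)) * g (Suc n)"
      using 1 2 by (simp add: M_def g_def algebra_simps)
    also have "\<dots> \<le> M n + \<kappa> * (M n * g (Suc n)) * g (Suc n)"
      using ynorm[of n] g0 k0 by (intro add_left_mono mult_right_mono mult_left_mono) auto
    finally show ?thesis by (simp add: algebra_simps power2_eq_square)
  qed
  have sg: "summable (\<lambda>n. (g n)\<^sup>2)"
    unfolding g_def by (rule summable_square_add[OF su sv])
  define C where "C = M 0 * exp (\<Sum>n. \<kappa> * (g (Suc n))\<^sup>2)"
  have "M n \<le> M 0 * (\<Prod>k<n. 1 + \<kappa> * (g (Suc k))\<^sup>2)" for n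
  proof (induction n)
    case (Suc n)
    have "M (Suc n) \<le> M n * (1 + \<kappa> * (g (Suc n))\<^sup>2)" by (rule step)
    also have "\<dots> \<le> M 0 * (\<Prod>k<n. 1 + \<kappa> * (g (Suc k))\<^sup>2) * (1 + \<kappa> * (g (Suc n))\<^sup>2)"
      using Suc k0 by (intro mult_right_mono) auto
    finally show ?case by (simp add: mult.assoc)
  qed simp
  moreover have "(\<Prod>k<n. 1 + \<kappa> * (g (Suc k))\<^sup>2) \<le> exp (\<Sum>n. \<kappa> * (g (Suc n))\<^sup>2)" for n
    using sg k0 by (intro prod_one_plus_bounded summable_mult) (auto simp: summable_Suc_iff[of "\<lambda>n. (g n)\<^sup>2"])
  ultimately have MC: "M n \<le> C" for n
    unfolding C_def using M0[of 0] by (meson mult_left_mono order_trans)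
  have "summable (\<lambda>n. (norm (y (Suc n)))\<^sup>2)"
  proof (rule summable_comparison_test')
    show "summable (\<lambda>n. C\<^sup>2 * (g (Suc n))\<^sup>2)"
      using sg by (intro summable_mult) (simp add: summable_Suc_iff[of "\<lambda>n. (g n)\<^sup>2"])
    fix n
    have "norm (y (Suc n)) \<le> C * g (Suc n)"
      using ynorm[of n] MC[of n] g0[of "Suc n"] by (meson mult_right_mono order_trans)
    hence "(norm (y (Suc n)))\<^sup>2 \<le> (C * g (Suc n))\<^sup>2" by (intro power_mono) auto
    thus "norm ((norm (y (Suc n)))\<^sup>2) \<le> C\<^sup>2 * (g (Suc n))\<^sup>2" by (simp add: power_mult_distrib)
  qed
  thus ?thesis by (simp add: summable_Suc_iff[of "\<lambda>n. (norm (y n))\<^sup>2"])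
qed

section \<open>Moment functionals and orthogonal polynomials\<close>

text \<open>The Riesz functional of the sequence, which sends the k-th power of the variable to
  \<open>s k\<close>.\<close>

definition moment_functional :: "(nat \<Rightarrow> real) \<Rightarrow> real poly \<Rightarrow> real" where
  "moment_functional s p = (\<Sum>i\<le>degree p. coeff p i * s i)"

lemma moment_functional_altdef:
  assumes "degree p \<le> N"
  shows "moment_functional s p = (\<Sum>i\<le>N. coeff p i * s i)"
  unfolding moment_functional_def
  by (rule sum.mono_neutral_left) (use assms in \<open>auto simp: coeff_eq_0\<close>)

lemma moment_functional_0 [simp]: "moment_functional s 0 = 0"
  by (simp add: moment_functional_def)

lemma moment_functional_add:
  "moment_functional s (p + q) = moment_functional s p + moment_functional s q"
proof -
  let ?N = "max (degree p) (degree q)"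
  show ?thesis
    by (subst (1 2 3) moment_functional_altdef[of _ ?N])
       (auto simp: degree_add_le algebra_simps sum.distrib)
qed

lemma moment_functional_smult:
  "moment_functional s (smult c p) = c * moment_functional s p"
  by (subst (1 2) moment_functional_altdef[of _ "degree p"])
     (auto simp: sum_distrib_left algebra_simps)

lemma moment_functional_sum:
  "moment_functional s (\<Sum>i\<in>A. f i) = (\<Sum>i\<in>A. moment_functional s (f i))"
  by (induction A rule: infinite_finite_induct) (auto simp: moment_functional_add)

lemma moment_functional_pCons:
  "moment_functional s (pCons c p) = c * s 0 + moment_functional (\<lambda>i. s (Suc i)) p"
proof -
  have "moment_functional s (pCons c p) = (\<Sum>i\<le>Suc (degree p). coeff (pCons c p) i * s i)"
    by (rule moment_functional_altdef) (rule degree_pCons_le)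
  also have "\<dots> = c * s 0 + moment_functional (\<lambda>i. s (Suc i)) p"
    by (subst sum.atMost_Suc_shift) (simp add: moment_functional_def)
  finally show ?thesis .
qed

lemma moment_functional_monom_mult:
  "moment_functional s (monom c j * p) = c * moment_functional (\<lambda>i. s (i + j)) p"
proof (induction j arbitrary: s)
  case 0
  show ?case by (simp add: monom_0 moment_functional_smult)
next
  case (Suc j)
  show ?case by (simp add: monom_Suc moment_functional_pCons Suc)
qed

text \<open>Multiplication by the j-th power of the variable acts on the functional as a shift of
  the sequence by \<open>j\<close>.\<close>

lemma moment_functional_mult:
  assumes "degree q \<le> N"
  shows "moment_functional s (q * p) = (\<Sum>j\<le>N. coeff q j * moment_functional (\<lambda>i. s (i + j)) p)"
proof -
  have "q * p = (\<Sum>j\<le>N. monom (coeff q j) j * p)"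
    using poly_as_sum_of_monoms'[OF assms] by (simp flip: sum_distrib_right)
  thus ?thesis
    by (simp add: moment_functional_sum moment_functional_monom_mult)
qed

text \<open>The powers of \<open>x\<close> are the moments of the unit mass at \<open>x\<close>; an
  atom can thus be subtracted at the level of moments.\<close>

lemma moment_functional_power: "moment_functional (\<lambda>k. x ^ k) p = poly p x"
  by (simp add: moment_functional_def poly_altdef)

lemma moment_functional_diff_seq:
  "moment_functional (\<lambda>k. s k - c * t k) p = moment_functional s p - c * moment_functional t p"
  by (simp add: moment_functional_def sum_subtractf sum_distrib_left algebra_simps)

text \<open>The monic orthogonal polynomial of degree \<open>n\<close>, multiplied by the Hankel determinant of
  size \<open>n\<close>: the coefficients are the cofactors of the last row, so that applying a functional
  \<open>r\<close> amounts to replacing that row by \<open>r\<close>.\<close>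
definition hankel_poly :: "(nat \<Rightarrow> real) \<Rightarrow> nat \<Rightarrow> real poly" where
  "hankel_poly s n =
     (\<Sum>k\<le>n. monom (cofactor (mat (Suc n) (Suc n) (\<lambda>(i, j). s (i + j))) n k) k)"

lemma coeff_hankel_poly:
  "coeff (hankel_poly s n) k =
     (if k \<le> n then cofactor (mat (Suc n) (Suc n) (\<lambda>(i, j). s (i + j))) n k else 0)"
  unfolding hankel_poly_def by (auto simp: coeff_sum sum.delta)

lemma degree_hankel_poly_le: "degree (hankel_poly s n) \<le> n"
  by (rule degree_le) (simp add: coeff_hankel_poly)

lemma hankel_det_0 [simp]: "hankel_det s 0 = 1"
  by (simp add: hankel_det_def)

lemma coeff_hankel_poly_lead: "coeff (hankel_poly s n) n = hankel_det s n"
proof -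
  have "mat_delete (mat (Suc n) (Suc n) (\<lambda>(i, j). s (i + j))) n n = mat n n (\<lambda>(i, j). s (i + j))"
    by (rule eq_matI) (auto simp: mat_delete_def)
  thus ?thesis
    by (simp add: coeff_hankel_poly cofactor_def hankel_det_def)
qed

lemma moment_functional_hankel_poly:
  "moment_functional r (hankel_poly s n) =
     Determinant.det (mat (Suc n) (Suc n) (\<lambda>(i, j). if i = n then r j else s (i + j)))"
proof -
  let ?H = "mat (Suc n) (Suc n) (\<lambda>(i, j). s (i + j))"
  let ?A = "mat (Suc n) (Suc n) (\<lambda>(i, j). if i = n then r j else s (i + j))"
  have "mat_delete ?A n k = mat_delete ?H n k" if "k \<le> n" for k
    using that by (intro eq_matI) (auto simp: mat_delete_def)
  hence cof: "cofactor ?A n k = cofactor ?H n k" if "k \<le> n" for k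
    using that by (simp add: cofactor_def)
  have "Determinant.det ?A = (\<Sum>j<Suc n. ?A $$ (n, j) * cofactor ?A n j)"
    by (rule laplace_expansion_row) auto
  also have "\<dots> = (\<Sum>j\<le>n. coeff (hankel_poly s n) j * r j)"
    by (rule sum.cong) (auto simp: cof coeff_hankel_poly mult.commute)
  also have "\<dots> = moment_functional r (hankel_poly s n)"
    by (rule moment_functional_altdef[symmetric]) (rule degree_hankel_poly_le)
  finally show ?thesis by simp
qed

text \<open>Testing against the j-th power puts row \<open>j\<close> of the Hankel matrix in place
  of the last row: a repeated row for \<open>j < n\<close>, the full Hankel matrix for
  \<open>j = n\<close>. This is the orthogonality.\<close>

lemma moment_functional_shift_hankel_poly:
  assumes "j \<le> n"
  shows "moment_functional (\<lambda>i. s (i + j)) (hankel_poly s n) =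
           (if j = n then hankel_det s (Suc n) else 0)"
proof (cases "j = n")
  case True
  have "mat (Suc n) (Suc n) (\<lambda>(i, k). if i = n then s (k + n) else s (i + k)) =
        mat (Suc n) (Suc n) (\<lambda>(i, k). s (i + k))"
    by (intro eq_matI) (auto simp: add.commute)
  thus ?thesis
    using True by (simp add: moment_functional_hankel_poly hankel_det_def)
next
  case False
  let ?A = "mat (Suc n) (Suc n) (\<lambda>(i, k). if i = n then s (k + j) else s (i + k))"
  have "Determinant.det ?A = 0"
  proof (rule Determinant.det_identical_rows)
    show "?A \<in> carrier_mat (Suc n) (Suc n)" "j \<noteq> n" "j < Suc n" "n < Suc n"
      using False assms by auto
    show "Matrix.row ?A j = Matrix.row ?A n"
      using False assms by (intro eq_vecI) (auto simp: add.commute)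
  qed
  thus ?thesis
    using False by (simp add: moment_functional_hankel_poly)
qed

lemma moment_functional_mult_hankel_poly:
  assumes "degree q \<le> n"
  shows "moment_functional s (q * hankel_poly s n) = coeff q n * hankel_det s (Suc n)"
proof -
  have "moment_functional s (q * hankel_poly s n) =
      (\<Sum>j\<le>n. if j = n then coeff q n * hankel_det s (Suc n) else 0)"
    unfolding moment_functional_mult[OF assms]
    by (rule sum.cong) (auto simp: moment_functional_shift_hankel_poly)
  thus ?thesis by simp
qed

text \<open>The constant coefficient is a corner cofactor: deleting the last row and first column
  shifts all indices by one.\<close>

lemma poly_hankel_poly_0: "poly (hankel_poly s n) 0 = (-1) ^ n * Delta1 s n"
proof -
  have "mat_delete (mat (Suc n) (Suc n) (\<lambda>(i, j). s (i + j))) n 0 =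
      mat n n (\<lambda>(i, j). s (i + j + 1))"
    by (rule eq_matI) (auto simp: mat_delete_def)
  hence "cofactor (mat (Suc n) (Suc n) (\<lambda>(i, j). s (i + j))) n 0 = (-1) ^ n * Delta1 s n"
    by (cases "n = 0") (simp_all add: cofactor_def Delta1_def hankel_det_def)
  thus ?thesis
    by (simp add: poly_0_coeff_0 coeff_hankel_poly)
qed

text \<open>Prepending the value 0 gives the functional p -> L((p(t) - p(0)) / t). On orthonormal
  polynomials it yields the second-kind polynomials at 0.\<close>

definition delayed :: "(nat \<Rightarrow> real) \<Rightarrow> nat \<Rightarrow> real" where
  "delayed s m = (if m = 0 then 0 else s (m - 1))"

lemma moment_functional_delayed_pCons:
  "moment_functional (delayed s) (pCons c p) = moment_functional s p"
  by (simp add: moment_functional_pCons delayed_def)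

text \<open>Below its first row, the Hankel matrix of \<open>delayed s\<close> consists of the first
  \<open>n\<close> rows of the matrix of \<open>s\<close>. Expanding along the first instead of the
  last row costs the sign \<open>(-1) ^ n\<close>. At \<open>n = 0\<close> both sides are 0 by
  convention.\<close>

lemma moment_functional_delayed_hankel_poly:
  "moment_functional (delayed s) (hankel_poly s n) = (-1) ^ n * Deltam1 s n"
proof (cases "n = 0")
  case True
  thus ?thesis
    using degree_hankel_poly_le[of s 0] by (simp add: moment_functional_def delayed_def Deltam1_def)
next
  case False
  let ?H = "mat (Suc n) (Suc n) (\<lambda>(i, j). s (i + j))"
  let ?M = "mat (Suc n) (Suc n) (\<lambda>(i, j). delayed s (i + j))"
  have "mat_delete ?M 0 k = mat_delete ?H n k" if "k \<le> n" for k
    using that by (intro eq_matI) (auto simp: mat_delete_def delayed_def)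
  hence cof: "cofactor ?M 0 k = (-1) ^ n * cofactor ?H n k" if "k \<le> n" for k
    using that by (simp add: cofactor_def power_add)
  have "(\<lambda>m. if m = 0 then 0 else s (m - 1)) = delayed s"
    by (simp add: fun_eq_iff delayed_def)
  hence "Deltam1 s n = Determinant.det ?M"
    using False by (simp add: Deltam1_def hankel_det_def)
  also have "\<dots> = (\<Sum>j<Suc n. ?M $$ (0, j) * cofactor ?M 0 j)"
    by (rule laplace_expansion_row) auto
  also have "\<dots> = (\<Sum>j\<le>n. (-1) ^ n * (coeff (hankel_poly s n) j * delayed s j))"
    by (rule sum.cong) (auto simp: cof coeff_hankel_poly)
  also have "\<dots> = (-1) ^ n * moment_functional (delayed s) (hankel_poly s n)"
    by (simp add: moment_functional_altdef[OF degree_hankel_poly_le] sum_distrib_left)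
  finally show ?thesis by simp
qed

section \<open>Orthonormal polynomials of a positive sequence and their three-term
  recurrence\<close>

locale positive_hankel =
  fixes s :: "nat \<Rightarrow> real"
  assumes hankel_det_pos: "hankel_det s n > 0"
begin

abbreviation D :: "nat \<Rightarrow> real" where "D \<equiv> hankel_det s"
abbreviation L :: "real poly \<Rightarrow> real" where "L \<equiv> moment_functional s"

text \<open>\<open>D\<close> is indexed by matrix size, so \<open>D n\<close> is \<Delta>_{0,n-1}.
  The squared norm of \<open>hankel_poly s n\<close> is \<open>D n * D (Suc n)\<close>, whence the
  normalisation.\<close>

definition orthopoly :: "nat \<Rightarrow> real poly" where
  "orthopoly n = smult (1 / sqrt (D n * D (Suc n))) (hankel_poly s n)"

text \<open>The off-diagonal Jacobi entry, as the quotient of the leading coefficients of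
  \<open>orthopoly n\<close> and \<open>orthopoly (Suc n)\<close>.\<close>

definition rec_b :: "nat \<Rightarrow> real" where "rec_b n = sqrt (D n * D (Suc (Suc n))) / D (Suc n)"
definition rec_a :: "nat \<Rightarrow> real" where "rec_a n = L (pCons 0 (orthopoly n) * orthopoly n)"

lemma D_nonzero [simp]: "D n \<noteq> 0"
  using hankel_det_pos[of n] by simp

lemma D_nonneg [simp]: "D n \<ge> 0"
  using hankel_det_pos[of n] by simp

lemma coeff_orthopoly_lead: "coeff (orthopoly n) n = sqrt (D n) / sqrt (D (Suc n))"
proof -
  have "D n / (sqrt (D n) * sqrt (D (Suc n))) = sqrt (D n) / sqrt (D (Suc n))"
    using real_div_sqrt[OF D_nonneg, of n] by (metis divide_divide_eq_left)
  thus ?thesis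
    by (simp add: orthopoly_def coeff_hankel_poly_lead real_sqrt_mult)
qed

lemma degree_orthopoly [simp]: "degree (orthopoly n) = n"
proof (rule antisym)
  show "degree (orthopoly n) \<le> n"
    unfolding orthopoly_def by (intro order_trans[OF degree_smult_le] degree_hankel_poly_le)
  show "n \<le> degree (orthopoly n)"
    by (intro le_degree) (simp add: coeff_orthopoly_lead)
qed

lemma L_mult_orthopoly:
  assumes "degree q \<le> n"
  shows "L (q * orthopoly n) = coeff q n * sqrt (D (Suc n)) / sqrt (D n)"
proof -
  have "D (Suc n) / (sqrt (D n) * sqrt (D (Suc n))) = sqrt (D (Suc n)) / sqrt (D n)"
    using real_div_sqrt[OF D_nonneg, of "Suc n"] by (metis divide_divide_eq_left mult.commute)
  moreover have "L (q * orthopoly n) = coeff q n * (D (Suc n) / (sqrt (D n) * sqrt (D (Suc n))))"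
    by (simp add: orthopoly_def moment_functional_smult moment_functional_mult_hankel_poly[OF assms]
        real_sqrt_mult)
  ultimately show ?thesis by simp
qed

lemma orthonormal: "L (orthopoly m * orthopoly n) = (if m = n then 1 else 0)"
proof -
  have *: "L (orthopoly m * orthopoly n) = (if m = n then 1 else 0)" if "m \<le> n" for m n
    using that by (subst L_mult_orthopoly) (auto simp: coeff_orthopoly_lead coeff_eq_0)
  show ?thesis
    using *[of m n] *[of n m] by (cases "m \<le> n") (auto simp: mult.commute)
qed

lemma orthopoly_expansion_exists:
  "degree q \<le> N \<Longrightarrow> \<exists>c. q = (\<Sum>k\<le>N. smult (c k) (orthopoly k))"
proof (induction N arbitrary: q)
  case 0
  then obtain c where q: "q = [:c:]" using degree_eq_zeroE by auto
  obtain d where d: "orthopoly 0 = [:d:]" using degree_orthopoly[of 0] degree_eq_zeroE by blast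
  have "d \<noteq> 0" using coeff_orthopoly_lead[of 0] d by auto
  show ?case by (rule exI[of _ "\<lambda>_. c / d"]) (simp add: q d \<open>d \<noteq> 0\<close>)
next
  case (Suc N)
  define a where "a = coeff q (Suc N) / coeff (orthopoly (Suc N)) (Suc N)"
  define r where "r = q - smult a (orthopoly (Suc N))"
  have "coeff r i = 0" if "i > N" for i
  proof (cases "i = Suc N")
    case True
    thus ?thesis by (simp add: r_def a_def coeff_orthopoly_lead)
  next
    case False
    thus ?thesis using that Suc.prems by (simp add: r_def coeff_eq_0)
  qed
  hence "degree r \<le> N" by (intro degree_le) auto
  then obtain c where c: "r = (\<Sum>k\<le>N. smult (c k) (orthopoly k))" using Suc.IH by blast
  have "q = (\<Sum>k\<le>Suc N. smult ((c(Suc N := a)) k) (orthopoly k))"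
    using c by (simp add: r_def algebra_simps)
  thus ?case by blast
qed

lemma orthopoly_expansion:
  assumes "degree q \<le> N"
  shows "q = (\<Sum>k\<le>N. smult (L (q * orthopoly k)) (orthopoly k))"
proof -
  obtain c where c: "q = (\<Sum>k\<le>N. smult (c k) (orthopoly k))"
    using orthopoly_expansion_exists[OF assms] by blast
  have "L (q * orthopoly j) = c j" if "j \<le> N" for j
  proof -
    have "L (q * orthopoly j) = (\<Sum>k\<le>N. if k = j then c j else 0)"
      unfolding c sum_distrib_right moment_functional_sum
      by (rule sum.cong) (auto simp: moment_functional_smult orthonormal)
    thus ?thesis using that by simp
  qed
  thus ?thesis by (subst c) (auto intro!: sum.cong)
qed

lemma L_square:
  assumes "degree q \<le> N"
  shows "L (q * q) = (\<Sum>k\<le>N. (L (q * orthopoly k))\<^sup>2)"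
proof -
  have "L (q * q) = L (q * (\<Sum>k\<le>N. smult (L (q * orthopoly k)) (orthopoly k)))"
    using orthopoly_expansion[OF assms] by simp
  thus ?thesis
    by (simp add: sum_distrib_left moment_functional_sum moment_functional_smult power2_eq_square)
qed

text \<open>By the Parseval identity \<open>L_square\<close>, a nonpositive value would make every
  Fourier coefficient vanish, and with them \<open>q\<close>.\<close>

lemma L_square_pos:
  assumes "q \<noteq> 0"
  shows "L (q * q) > 0"
proof (rule ccontr)
  assume "\<not> L (q * q) > 0"
  hence "(\<Sum>k\<le>degree q. (L (q * orthopoly k))\<^sup>2) = 0"
    using L_square[of q "degree q"] by (simp add: sum_nonneg antisym)
  hence "\<forall>k\<le>degree q. L (q * orthopoly k) = 0"
    by (subst (asm) sum_nonneg_eq_0_iff) auto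
  hence "q = 0"
    using orthopoly_expansion[of q "degree q"] by simp
  with assms show False by simp
qed

lemma L_pCons_orthopoly: "L (pCons 0 (orthopoly n) * orthopoly (Suc n)) = rec_b n"
  by (subst L_mult_orthopoly)
     (auto simp: coeff_orthopoly_lead rec_b_def real_sqrt_mult field_simps
       intro: order_trans[OF degree_pCons_le])

text \<open>Multiplication by the variable is symmetric for \<open>L\<close>; moved to the other
  factor, it gives too low a degree for the coefficients with \<open>k < n\<close> to
  survive.\<close>

lemma orthopoly_recurrence:
  "pCons 0 (orthopoly (Suc n)) = smult (rec_b (Suc n)) (orthopoly (Suc (Suc n)))
     + smult (rec_a (Suc n)) (orthopoly (Suc n)) + smult (rec_b n) (orthopoly n)"
proof -
  define c where "c k = L (pCons 0 (orthopoly (Suc n)) * orthopoly k)" for k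
  have "c k = 0" if "k < n" for k
  proof -
    have "c k = L (pCons 0 (orthopoly k) * orthopoly (Suc n))"
      by (simp add: c_def mult.commute)
    also have "\<dots> = 0"
      using that by (subst L_mult_orthopoly) (auto simp: coeff_eq_0 intro: order_trans[OF degree_pCons_le])
    finally show ?thesis .
  qed
  moreover have "c n = rec_b n"
    using L_pCons_orthopoly[of n] by (simp add: c_def mult.commute)
  moreover have "c (Suc n) = rec_a (Suc n)" by (simp add: c_def rec_a_def)
  moreover have "c (Suc (Suc n)) = rec_b (Suc n)"
    using L_pCons_orthopoly[of "Suc n"] by (simp add: c_def)
  moreover have "pCons 0 (orthopoly (Suc n)) = (\<Sum>k\<le>Suc (Suc n). smult (c k) (orthopoly k))"
    unfolding c_def by (rule orthopoly_expansion) (auto intro: order_trans[OF degree_pCons_le])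
  ultimately show ?thesis
    by (simp flip: lessThan_Suc_atMost)
qed

text \<open>Row 0, absent from \<open>jacobi_solution\<close>; it supplies the initial values from
  which the Casoratians are computed.\<close>

lemma orthopoly_recurrence_0:
  "pCons 0 (orthopoly 0) = smult (rec_b 0) (orthopoly (Suc 0)) + smult (rec_a 0) (orthopoly 0)"
proof -
  have "pCons 0 (orthopoly 0) =
      (\<Sum>k\<le>Suc 0. smult (L (pCons 0 (orthopoly 0) * orthopoly k)) (orthopoly k))"
    by (rule orthopoly_expansion) (auto intro: order_trans[OF degree_pCons_le])
  thus ?thesis
    by (simp add: rec_a_def L_pCons_orthopoly del: mult_pCons_left)
qed

lemma L_orthopoly_Suc: "L (orthopoly (Suc n)) = 0"
  using L_mult_orthopoly[of 1 "Suc n"] by simp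

section \<open>Values at the origin: second-kind solution, Casoratian and determinant
  identity\<close>

definition second_kind :: "nat \<Rightarrow> real" where
  "second_kind n = moment_functional (delayed s) (orthopoly n)"

lemma jacobi_solution_orthopoly: "jacobi_solution rec_a rec_b x (\<lambda>n. poly (orthopoly n) x)"
  unfolding jacobi_solution_def
proof
  fix n
  show "rec_b (Suc n) * poly (orthopoly (Suc (Suc n))) x + rec_a (Suc n) * poly (orthopoly (Suc n)) x
      + rec_b n * poly (orthopoly n) x = x * poly (orthopoly (Suc n)) x"
    using arg_cong[OF orthopoly_recurrence[of n], of "\<lambda>p. poly p x"] by simp
qed

text \<open>The delayed functional strips the factor t and leaves
  \<open>L (orthopoly (Suc n))\<close>, which is 0 by orthogonality to constants.\<close>

lemma jacobi_solution_second_kind: "jacobi_solution rec_a rec_b 0 second_kind"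
  unfolding jacobi_solution_def
proof
  fix n
  show "rec_b (Suc n) * second_kind (Suc (Suc n)) + rec_a (Suc n) * second_kind (Suc n)
      + rec_b n * second_kind n = 0 * second_kind (Suc n)"
    using arg_cong[OF orthopoly_recurrence[of n], of "moment_functional (delayed s)"]
    by (simp add: moment_functional_delayed_pCons moment_functional_add moment_functional_smult
        L_orthopoly_Suc second_kind_def)
qed

text \<open>Constancy reduces this to index 0, where \<open>second_kind 0 = 0\<close> and row 0
  gives \<open>rec_b 0 * second_kind (Suc 0) = L (orthopoly 0)\<close>, the reciprocal of the
  constant \<open>orthopoly 0\<close>.\<close>

lemma casoratian_orthopoly_second_kind:
  "casoratian rec_b (\<lambda>n. poly (orthopoly n) 0) second_kind n = -1"
proof -
  obtain d where d: "orthopoly 0 = [:d:]" using degree_orthopoly[of 0] degree_eq_zeroE by blast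
  have q0: "second_kind 0 = 0"
    by (simp add: second_kind_def d moment_functional_delayed_pCons)
  have "moment_functional (delayed s) (pCons 0 (orthopoly 0)) =
      rec_b 0 * second_kind (Suc 0) + rec_a 0 * second_kind 0"
    unfolding orthopoly_recurrence_0
    by (simp add: moment_functional_add moment_functional_smult second_kind_def)
  hence "L [:d:] = rec_b 0 * second_kind (Suc 0)"
    by (simp add: q0 d moment_functional_delayed_pCons)
  moreover have "d * L [:d:] = 1"
    using orthonormal[of 0 0] moment_functional_smult[of s d "[:d:]"] by (simp add: d)
  ultimately have "casoratian rec_b (\<lambda>n. poly (orthopoly n) 0) second_kind 0 = -1"
    by (simp add: casoratian_def q0 d algebra_simps)
  thus ?thesis
    using casoratian_const[OF jacobi_solution_orthopoly[of 0] jacobi_solution_second_kind] by simp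
qed

lemma poly_orthopoly_0: "poly (orthopoly n) 0 = (-1) ^ n * Delta1 s n / sqrt (D n * D (Suc n))"
  by (simp add: orthopoly_def poly_hankel_poly_0)

lemma second_kind_eq: "second_kind n = (-1) ^ n * Deltam1 s n / sqrt (D n * D (Suc n))"
  by (simp add: second_kind_def orthopoly_def moment_functional_smult
      moment_functional_delayed_hankel_poly)

text \<open>The Casoratian rewritten in determinants. It governs both the gaps between the indices
  k(j) and the telescoping of the \<omega>_j.\<close>

lemma Delta_wronskian:
  "Delta1 s (Suc n) * Deltam1 s n - Delta1 s n * Deltam1 s (Suc n) = (D (Suc n))\<^sup>2"
proof -
  let ?W = "Delta1 s (Suc n) * Deltam1 s n - Delta1 s n * Deltam1 s (Suc n)"
  have sq: "((- 1) ^ n * (- 1) ^ n :: real) = 1" by (simp flip: power_mult_distrib)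
  have "-1 = rec_b n * (- ?W / (sqrt (D n) * sqrt (D (Suc n)) * (sqrt (D (Suc n)) * sqrt (D (Suc (Suc n))))))"
    using casoratian_orthopoly_second_kind[of n] sq
    unfolding casoratian_def poly_orthopoly_0 second_kind_eq
    by (simp add: real_sqrt_mult field_simps)
  also have "\<dots> = - ?W / (D (Suc n))\<^sup>2"
    unfolding rec_b_def
    by (simp add: real_sqrt_mult power2_eq_square)
  finally show ?thesis by (simp add: field_simps)
qed

end

text \<open>By induction: \<open>hankel_poly s n\<close> has leading coefficient
  \<open>hankel_det s n\<close>, so it is nonzero, and the functional of its square is the product
  of two consecutive determinants.\<close>

lemma positive_hankelI:
  assumes pos: "\<And>q. q \<noteq> 0 \<Longrightarrow> moment_functional s (q * q) > 0"
  shows "positive_hankel s"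
proof
  fix n
  show "hankel_det s n > 0"
  proof (induction n)
    case (Suc n)
    have "hankel_poly s n \<noteq> 0"
      using coeff_hankel_poly_lead[of s n] Suc by auto
    hence "hankel_det s n * hankel_det s (Suc n) > 0"
      using pos[of "hankel_poly s n"] moment_functional_mult_hankel_poly[OF degree_hankel_poly_le[of s n]]
      by (simp add: coeff_hankel_poly_lead)
    thus ?case using Suc by (simp add: zero_less_mult_iff)
  qed simp
qed

lemma Delta0_int: "Delta0 s (int n) = hankel_det s (Suc n)"
  by (simp add: Delta0_def)

lemma Delta0_int_minus_1: "Delta0 s (int n - 1) = hankel_det s n"
  by (cases n) (auto simp: Delta0_def)

lemma strictly_positive_imp_positive_hankel:
  assumes "strictly_positive s"
  shows "positive_hankel s"
proof
  fix n
  show "hankel_det s n > 0"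
    using assms by (cases n) (auto simp: strictly_positive_def Delta0_int)
qed

section \<open>Gauss quadrature\<close>

lemma poly_map_of_real_add:
  "poly (map_poly complex_of_real (p + q)) z =
     poly (map_poly complex_of_real p) z + poly (map_poly complex_of_real q) z"
proof -
  have "map_poly complex_of_real (p + q) = map_poly complex_of_real p + map_poly complex_of_real q"
    by (intro poly_eqI) (simp add: coeff_map_poly)
  thus ?thesis by simp
qed

lemma poly_map_of_real_mult:
  "poly (map_poly complex_of_real (p * q)) z =
     poly (map_poly complex_of_real p) z * poly (map_poly complex_of_real q) z"
proof (induction p)
  case (pCons c p)
  have "map_poly complex_of_real (smult c q) = smult (complex_of_real c) (map_poly complex_of_real q)"
    by (intro poly_eqI) (simp add: coeff_map_poly)
  thus ?case
    using pCons by (simp add: poly_map_of_real_add map_poly_pCons algebra_simps)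
qed simp

text \<open>At a non-real root x + iy, the remainder modulo (t - x)^2 + y^2 is real of degree at
  most 1 and vanishes there, so it is zero. The factor is kept as a sum of squares because
  positivity of \<open>L\<close> is applied to it.\<close>

lemma real_poly_real_or_quadratic_factor:
  fixes g :: "real poly"
  assumes "degree g > 0"
  obtains (real) x where "poly g x = 0"
    | (quadratic) x y where "y \<noteq> 0" "([:- x, 1:] * [:- x, 1:] + [:y * y:]) dvd g"
proof -
  let ?E = "\<lambda>p z. poly (map_poly complex_of_real p) z"
  have "degree (map_poly complex_of_real g) > 0"
    using assms by (simp add: degree_map_poly)
  hence "\<not> constant (poly (map_poly complex_of_real g))"
    by (simp add: constant_degree)
  then obtain z where z: "?E g z = 0"
    using Fundamental_Theorem_Algebra.fundamental_theorem_of_algebra by blast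
  define x y where "x = Re z" and "y = Im z"
  show ?thesis
  proof (cases "y = 0")
    case True
    hence "z = complex_of_real x" by (simp add: x_def y_def complex_eq_iff)
    moreover have "?E g (complex_of_real x) = complex_of_real (poly g x)"
      by (induction g) (simp_all add: map_poly_pCons)
    ultimately have "poly g x = 0" using z by simp
    thus ?thesis by (rule real)
  next
    case False
    define c where "c = [:- x, 1:] * [:- x, 1:] + [:y * y:]"
    have c: "c = [:x * x + y * y, - 2 * x, 1:]" by (simp add: c_def)
    define r where "r = g mod c"
    have "c \<noteq> 0" "degree c = 2" by (simp_all add: c)
    hence "degree r < 2" using degree_mod_less[of c g] by (auto simp: r_def)
    then obtain r0 r1 where r: "r = [:r0, r1:]"
      by (metis One_nat_def Suc_1 degree_pCons_eq_if less_Suc_eq_le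
          pCons_cases degree_eq_zeroE le_zero_eq pCons_0_0 not_less_eq_eq zero_less_Suc less_Suc_eq)
    have "?E c z = 0"
      by (simp add: c map_poly_pCons complex_eq_iff x_def y_def algebra_simps power2_eq_square)
    moreover have "?E g z = ?E (g div c) z * ?E c z + ?E r z"
      unfolding poly_map_of_real_mult[symmetric] poly_map_of_real_add[symmetric] r_def by simp
    ultimately have "?E r z = 0" using z by simp
    hence "r1 = 0" "r0 = 0"
      using False by (auto simp: r map_poly_pCons complex_eq_iff x_def y_def)
    hence "g mod c = 0" using r by (simp add: r_def)
    hence "c dvd g" by auto
    thus ?thesis using False quadratic unfolding c_def by blast
  qed
qed

lemma prod_linear_factors_dvd:
  fixes p :: "'a::idom poly"
  assumes "finite S" "\<And>x. x \<in> S \<Longrightarrow> poly p x = 0"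
  shows "(\<Prod>x\<in>S. [:- x, 1:]) dvd p"
  using assms
proof (induction S rule: finite_induct)
  case (insert x S)
  then obtain g where g: "p = (\<Prod>x\<in>S. [:- x, 1:]) * g" by (auto elim: dvdE)
  have "poly (\<Prod>x\<in>S. [:- x, 1:]) x \<noteq> 0"
    using insert.hyps by (auto simp: poly_prod)
  hence "poly g x = 0"
    using insert.prems[of x] by (simp add: g)
  hence "[:- x, 1:] dvd g" by (simp add: poly_eq_0_iff_dvd)
  thus ?case
    using insert.hyps by (simp add: g mult.commute[of "[:- x, 1:]"] mult_dvd_mono del: mult_pCons_left mult_pCons_right)
qed simp

context positive_hankel
begin

text \<open>A non-real or multiple root of \<open>orthopoly n\<close> would give a factorisation
  \<open>orthopoly n = ((t - x)\<^sup>2 + y\<^sup>2) h\<close>, and then \<open>L (orthopoly n \<cdot> h) = L (((t - x) h)\<^sup>2) + y\<^sup>2 L (h\<^sup>2) > 0\<close>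
  contradicts orthogonality.\<close>
lemma not_quadratic_dvd_orthopoly:
  "\<not> ([:- x, 1:] * [:- x, 1:] + [:y * y:]) dvd orthopoly n"
proof
  define f where "f = [:- x, 1:]"
  assume "([:- x, 1:] * [:- x, 1:] + [:y * y:]) dvd orthopoly n"
  then obtain h where h: "orthopoly n = (f * f + [:y * y:]) * h" unfolding f_def by (elim dvdE)
  have "orthopoly n \<noteq> 0" using coeff_orthopoly_lead[of n] by auto
  hence h0: "h \<noteq> 0" and q0: "f * f + [:y * y:] \<noteq> 0" using h by auto
  have "degree (f * f + [:y * y:]) = 2" by (simp add: f_def)
  hence n: "n = 2 + degree h"
    using degree_mult_eq[OF q0 h0] degree_orthopoly[of n] h by simp
  hence "L (h * orthopoly n) = 0"
    by (subst L_mult_orthopoly) (auto simp: coeff_eq_0)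
  moreover have "h * orthopoly n = (f * h) * (f * h) + smult (y * y) (h * h)"
    by (simp add: h algebra_simps)
  moreover have "f * h \<noteq> 0" using h0 by (simp add: f_def del: mult_pCons_left)
  ultimately show False
    using L_square_pos[of "f * h"] L_square_pos[OF h0]
    by (simp add: moment_functional_add moment_functional_smult add_pos_nonneg del: mult_pCons_left)
       (metis add_pos_nonneg less_irrefl mult_nonneg_nonneg zero_le_square less_imp_le)
qed

text \<open>After dividing out each real root once, a nonconstant cofactor would produce a non-real
  pair or a double root; both are excluded by \<open>not_quadratic_dvd_orthopoly\<close>, the latter
  with \<open>y = 0\<close>.\<close>

lemma card_roots_orthopoly: "card {x. poly (orthopoly n) x = 0} = n"
proof -
  let ?R = "{x. poly (orthopoly n) x = 0}"
  have nz: "orthopoly n \<noteq> 0" using coeff_orthopoly_lead[of n] by auto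
  hence fin: "finite ?R" by (rule poly_roots_finite)
  obtain g where g: "orthopoly n = (\<Prod>x\<in>?R. [:- x, 1:]) * g"
    using prod_linear_factors_dvd[OF fin, of "orthopoly n"] by (auto elim: dvdE)
  have "degree g = 0"
  proof (rule ccontr)
    assume "degree g \<noteq> 0"
    hence "degree g > 0" by simp
    thus False
    proof (cases rule: real_poly_real_or_quadratic_factor)
      case (real x)
      hence "[:- x, 1:] dvd g" by (simp add: poly_eq_0_iff_dvd)
      moreover have "x \<in> ?R" using real by (subst g) simp
      hence "[:- x, 1:] dvd (\<Prod>x\<in>?R. [:- x, 1:])" using fin by (intro dvd_prodI)
      ultimately have "[:- x, 1:] * [:- x, 1:] dvd orthopoly n"
        by (subst g) (intro mult_dvd_mono)
      thus False using not_quadratic_dvd_orthopoly[of x 0 n] by simp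
    next
      case (quadratic x y)
      have "g dvd orthopoly n" by (metis g dvd_triv_right)
      thus False using not_quadratic_dvd_orthopoly dvd_trans[OF quadratic(2)] by blast
    qed
  qed
  moreover have "degree (\<Prod>x\<in>?R. [:- x, 1:]) = card ?R"
    by (subst degree_prod_eq_sum_degree) auto
  moreover have "(\<Prod>x\<in>?R. [:- x, 1:]) \<noteq> 0" "g \<noteq> 0"
    using nz g by (metis mult_zero_left, metis mult_zero_right)
  hence "n = degree (\<Prod>x\<in>?R. [:- x, 1:]) + degree g"
    using degree_mult_eq g degree_orthopoly[of n] by metis
  ultimately show ?thesis by simp
qed

text \<open>The nodes are the zeros of \<open>orthopoly n\<close>. Interpolation is exact below
  degree n, and division by \<open>orthopoly n\<close> extends this below 2n since the quotient is
  orthogonal to it. Each weight is \<open>L (l x * l x)\<close> for a Lagrange basis polynomial,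
  hence positive.\<close>

lemma gauss_quadrature:
  assumes "n > 0"
  obtains R w where "finite R" "\<And>x. x \<in> R \<Longrightarrow> w x > 0"
    "\<And>p. degree p < 2 * n \<Longrightarrow> L p = (\<Sum>x\<in>R. w x * poly p x)"
proof -
  define R where "R = {x. poly (orthopoly n) x = 0}"
  have cR: "card R = n" unfolding R_def by (rule card_roots_orthopoly)
  hence fin: "finite R" using assms by (metis card.infinite less_irrefl)
  have nz: "orthopoly n \<noteq> 0" using coeff_orthopoly_lead[of n] by auto
  define l where "l x = (\<Prod>r\<in>R - {x}. smult (1 / (x - r)) [:- r, 1:])" for x
  have poly_l: "poly (l x) y = (if x = y then 1 else 0)" if "x \<in> R" "y \<in> R" for x y
  proof (cases "x = y")
    case True
    thus ?thesis by (simp add: l_def poly_prod) (intro prod.neutral, auto simp flip: diff_divide_distrib)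
  next
    case False
    hence "\<exists>r\<in>R - {x}. poly (smult (1 / (x - r)) [:- r, 1:]) y = 0"
      using that by (intro bexI[of _ y]) auto
    thus ?thesis using False fin by (auto simp: l_def poly_prod prod_zero_iff)
  qed
  have deg_l: "degree (l x) < n" if "x \<in> R" for x
  proof -
    have "degree (l x) \<le> sum (degree \<circ> (\<lambda>r. smult (1 / (x - r)) [:- r, 1:])) (R - {x})"
      unfolding l_def using fin by (intro degree_prod_sum_le) auto
    also have "\<dots> \<le> (\<Sum>r\<in>R - {x}. 1)" by (intro sum_mono) auto
    also have "\<dots> = n - 1" using that fin cR by simp
    finally show ?thesis using assms by simp
  qed
  define w where "w x = L (l x)" for x
  have quad_low: "L p = (\<Sum>x\<in>R. w x * poly p x)" if "degree p < n" for p
  proof -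
    have "p = (\<Sum>x\<in>R. smult (poly p x) (l x))"
    proof (rule poly_eqI_degree[of R])
      fix y assume "y \<in> R"
      have "(\<Sum>x\<in>R. poly p x * poly (l x) y) = (\<Sum>x\<in>R. if x = y then poly p y else 0)"
        using \<open>y \<in> R\<close> by (intro sum.cong) (auto simp: poly_l)
      thus "poly p y = poly (\<Sum>x\<in>R. smult (poly p x) (l x)) y"
        using \<open>y \<in> R\<close> fin by (simp add: poly_sum)
    next
      show "degree p < card R" using that cR by simp
      have "degree (\<Sum>x\<in>R. smult (poly p x) (l x)) \<le> n - 1"
        using deg_l by (intro degree_sum_le fin order_trans[OF degree_smult_le]) fastforce
      thus "degree (\<Sum>x\<in>R. smult (poly p x) (l x)) < card R" using assms cR by simp
    qed
    hence "L p = L (\<Sum>x\<in>R. smult (poly p x) (l x))" by simp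
    thus ?thesis by (simp add: moment_functional_sum moment_functional_smult w_def mult.commute)
  qed
  have quad: "L p = (\<Sum>x\<in>R. w x * poly p x)" if "degree p < 2 * n" for p
  proof -
    define q r where "q = p div orthopoly n" and "r = p mod orthopoly n"
    have p: "p = q * orthopoly n + r"
      unfolding q_def r_def by (rule div_mult_mod_eq[symmetric])
    have dr: "degree r < n"
      using degree_mod_less[OF nz, of p] assms by (auto simp: r_def)
    have "L (q * orthopoly n) = 0"
    proof (cases "q = 0")
      case False
      have "degree (q * orthopoly n) \<le> max (degree p) (degree r)"
        using degree_diff_le_max[of p r] by (simp add: p)
      hence "degree q < n"
        using that dr degree_mult_eq[OF False nz] by simp
      thus ?thesis by (subst L_mult_orthopoly) (auto simp: coeff_eq_0)
    qed simp
    hence "L p = L r" by (simp add: p moment_functional_add)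
    also have "\<dots> = (\<Sum>x\<in>R. w x * poly r x)" by (rule quad_low[OF dr])
    also have "\<dots> = (\<Sum>x\<in>R. w x * poly p x)"
      by (rule sum.cong) (auto simp: p R_def)
    finally show ?thesis .
  qed
  have "w x > 0" if "x \<in> R" for x
  proof -
    have "degree (l x * l x) < 2 * n"
      using degree_mult_le[of "l x" "l x"] deg_l[OF that] by simp
    hence "L (l x * l x) = (\<Sum>y\<in>R. if y = x then w x else 0)"
      using that by (subst quad) (auto simp: poly_l intro!: sum.cong)
    hence "w x = L (l x * l x)" using that fin by simp
    moreover have "l x \<noteq> 0" using poly_l[OF that that] by auto
    ultimately show ?thesis using L_square_pos by simp
  qed
  thus thesis using that fin quad by blast
qed

end

section \<open>Existence of solutions\<close>

text \<open>Truncation makes powers bounded and continuous, as weak convergence requires.\<close>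

definition clip :: "real \<Rightarrow> real \<Rightarrow> real" where
  "clip R t = max (- R) (min R t)"

lemma isCont_clip_power: "isCont (\<lambda>t. clip R t ^ k) t"
  unfolding clip_def by (intro continuous_intros)

lemma abs_clip_le: "\<bar>clip R t\<bar> \<le> \<bar>t\<bar>" if "R \<ge> 0"
  using that by (auto simp: clip_def)

lemma abs_clip_le_bound: "\<bar>clip R t\<bar> \<le> R" if "R \<ge> 0"
  using that by (auto simp: clip_def)

lemma clip_eq: "clip R t = t" if "\<bar>t\<bar> \<le> R"
  using that by (auto simp: clip_def)

lemma borel_measurable_clip [measurable]: "clip R \<in> borel_measurable borel"
  unfolding clip_def by measurable

text \<open>An error occurs only where \<bar>t\<bar> > R \<ge> 1; there the exponent may be raised
  and a factor \<bar>t\<bar> / R inserted. The even exponent makes the bound a nonnegative moment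
  integrand.\<close>

lemma clip_power_error:
  assumes "R \<ge> 1"
  shows "\<bar>t ^ k - clip R t ^ k\<bar> \<le> 2 * t ^ (2 * k + 2) / R"
proof (cases "\<bar>t\<bar> \<le> R")
  case True
  have "0 \<le> 2 * t ^ (2 * k + 2) / R"
    using assms by (intro divide_nonneg_pos mult_nonneg_nonneg zero_le_even_power) auto
  thus ?thesis by (simp only: clip_eq[OF True] diff_self abs_zero)
next
  case False
  have "\<bar>t ^ k - clip R t ^ k\<bar> \<le> \<bar>t\<bar> ^ k + \<bar>clip R t\<bar> ^ k"
    by (metis abs_triangle_ineq4 power_abs)
  also have "\<dots> \<le> 2 * \<bar>t\<bar> ^ k"
    using abs_clip_le[of R t] assms power_mono[of "\<bar>clip R t\<bar>" "\<bar>t\<bar>" k] by simp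
  also have "\<dots> \<le> 2 * \<bar>t\<bar> ^ (2 * k + 1)"
    using False assms by (intro mult_left_mono power_increasing) auto
  also have "\<dots> = 2 * \<bar>t\<bar> ^ (2 * k + 1) * 1" by simp
  also have "\<dots> \<le> 2 * \<bar>t\<bar> ^ (2 * k + 1) * (\<bar>t\<bar> / R)"
    using False assms by (intro mult_left_mono) auto
  also have "\<dots> = 2 * \<bar>t\<bar> ^ (2 * (k + 1)) / R" by simp
  also have "\<bar>t\<bar> ^ (2 * (k + 1)) = t ^ (2 * (k + 1))" by (simp add: power_mult)
  finally show ?thesis by simp
qed

lemma (in real_distribution) integrable_clip_power:
  assumes "R \<ge> 0"
  shows "integrable M (\<lambda>t. clip R t ^ k)"
proof (rule integrable_const_bound)
  show "AE t in M. norm (clip R t ^ k) \<le> R ^ k"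
    using abs_clip_le_bound[OF assms] by (intro AE_I2) (simp add: power_abs power_mono)
qed simp

lemma (in real_distribution) expectation_clip_power_error:
  assumes "R \<ge> 1" "integrable M (\<lambda>t. t ^ k)" "integrable M (\<lambda>t. t ^ (2 * k + 2))"
  shows "\<bar>(\<integral>t. t ^ k \<partial>M) - (\<integral>t. clip R t ^ k \<partial>M)\<bar> \<le> 2 * (\<integral>t. t ^ (2 * k + 2) \<partial>M) / R"
proof -
  have int: "integrable M (\<lambda>t. clip R t ^ k)" using assms by (intro integrable_clip_power) auto
  have "\<bar>\<integral>t. t ^ k - clip R t ^ k \<partial>M\<bar> \<le> (\<integral>t. \<bar>t ^ k - clip R t ^ k\<bar> \<partial>M)"
    by (rule integral_abs_bound)
  also have "\<dots> \<le> (\<integral>t. 2 * t ^ (2 * k + 2) / R \<partial>M)"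
    using assms int by (intro integral_mono clip_power_error) auto
  finally show ?thesis using assms int by simp
qed

text \<open>Chebyshev's inequality, with the half-open interval that \<open>tight\<close> asks
  for.\<close>

lemma (in real_distribution) tail_le:
  assumes "R > 0" "integrable M (\<lambda>t. t ^ 2)"
  shows "measure M {- R <.. R} \<ge> 1 - (\<integral>t. t ^ 2 \<partial>M) / R\<^sup>2"
proof -
  have "measure M {t \<in> space M. R\<^sup>2 \<le> t\<^sup>2} \<le> (\<integral>t. t ^ 2 \<partial>M) / R\<^sup>2"
    using assms by (intro integral_Markov_inequality_measure[where A = "{}"]) auto
  moreover have "1 = measure M (space M)" by (rule prob_space[symmetric])
  moreover have "measure M (space M) \<le> measure M ({t \<in> space M. R\<^sup>2 \<le> t\<^sup>2} \<union> {- R <.. R})"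
  proof (rule finite_measure_mono)
    show "space M \<subseteq> {t \<in> space M. R\<^sup>2 \<le> t\<^sup>2} \<union> {- R<..R}"
    proof
      fix t assume "t \<in> space M"
      show "t \<in> {t \<in> space M. R\<^sup>2 \<le> t\<^sup>2} \<union> {- R<..R}"
        using assms(1) abs_le_square_iff[of R t] \<open>t \<in> space M\<close> by auto
    qed
  qed simp
  moreover have "measure M ({t \<in> space M. R\<^sup>2 \<le> t\<^sup>2} \<union> {- R <.. R}) \<le>
      measure M {t \<in> space M. R\<^sup>2 \<le> t\<^sup>2} + measure M {- R <.. R}"
    by (rule measure_Un_le) simp_all
  ultimately show ?thesis by linarith
qed

text \<open>The second moment gives tightness, and Helly selection a weak limit. Powers are clipped
  to be bounded; a higher even moment, fixed along the sequence, makes the clipping error uniformly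
  small.\<close>

theorem moment_limit:
  fixes M :: "nat \<Rightarrow> real measure" and m :: "nat \<Rightarrow> real"
  assumes dist: "\<And>n. real_distribution (M n)"
    and mom: "\<And>n k. k \<le> n \<Longrightarrow> has_bochner_integral (M n) (\<lambda>t. t ^ k) (m k)"
  obtains N where "real_distribution N" "\<And>k. has_bochner_integral N (\<lambda>t. t ^ k) (m k)"
proof -
  have int: "integrable (M n) (\<lambda>t. t ^ k)" "(\<integral>t. t ^ k \<partial>M n) = m k" if "k \<le> n" for n k
    using mom[OF that] by (auto simp: has_bochner_integral_iff)
  \<comment> \<open>The index shift by 2 ensures that every member has second moment
    \<open>m 2\<close>.\<close>
  have tight: "tight (\<lambda>n. M (n + 2))"
    unfolding tight_def
  proof (intro conjI allI impI)
    show "real_distribution (M (n + 2))" for n by (rule dist)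
    fix \<epsilon> :: real assume "\<epsilon> > 0"
    define R where "R = sqrt (\<bar>m 2\<bar> / \<epsilon> + 1)"
    have "\<bar>m 2\<bar> / \<epsilon> + 1 > 0" using \<open>\<epsilon> > 0\<close> by (simp add: add_nonneg_pos)
    hence R: "R > 0" "R\<^sup>2 = \<bar>m 2\<bar> / \<epsilon> + 1" by (auto simp: R_def)
    have "m 2 / R\<^sup>2 < \<epsilon>"
    proof -
      have "m 2 < \<epsilon> * R\<^sup>2" using \<open>\<epsilon> > 0\<close> unfolding R(2) by (simp add: algebra_simps)
      thus ?thesis using R(1) by (simp add: field_simps)
    qed
    hence "measure (M (n + 2)) {- R <.. R} > 1 - \<epsilon>" for n
      using real_distribution.tail_le[OF dist R(1), of "n + 2"] int[of 2 "n + 2"] by simp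
    thus "\<exists>a b. a < b \<and> (\<forall>n. 1 - \<epsilon> < measure (M (n + 2)) {a<..b})"
      using R(1) by (intro exI[of _ "- R"] exI[of _ R]) auto
  qed
  obtain r N where r: "strict_mono (r :: nat \<Rightarrow> nat)" and N: "real_distribution N"
    and conv: "weak_conv_m ((\<lambda>n. M (n + 2)) \<circ> id \<circ> r) N"
    using tight_imp_convergent_subsubsequence[OF tight, of id] by (auto simp: strict_mono_id)
  interpret N: real_distribution N by (rule N)
  define K where "K n = M (r n + 2)" for n
  have K: "weak_conv_m K N" using conv by (simp add: K_def[abs_def] comp_def)
  have K_dist: "real_distribution (K n)" for n unfolding K_def by (rule dist)
  have K_int: "integrable (K n) (\<lambda>t. t ^ k)" "(\<integral>t. t ^ k \<partial>K n) = m k" if "k \<le> n" for n k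
    using int[of k "r n + 2"] that seq_suble[OF r, of n] by (auto simp: K_def)
  have clip_lim: "(\<lambda>n. \<integral>t. clip R t ^ k \<partial>K n) \<longlonglongrightarrow> (\<integral>t. clip R t ^ k \<partial>N)" if "R \<ge> 0" for R k
    using abs_clip_le_bound[OF that]
    by (intro weak_conv_imp_integral_bdd_continuous_conv[OF K_dist N K, where B = "R ^ k"] isCont_clip_power)
       (simp add: power_abs power_mono)
  \<comment> \<open>Fatou's lemma over growing clipping levels: each clipped even power integrates
    to at most \<open>m (2 * k)\<close>.\<close>
  have even_int: "integrable N (\<lambda>t. t ^ (2 * k))" and even_le: "(\<integral>t. t ^ (2 * k) \<partial>N) \<le> m (2 * k)" for k
  proof -
    have clip_le: "(\<integral>t. clip R t ^ (2 * k) \<partial>N) \<le> m (2 * k)" if "R \<ge> 0" for R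
    proof (rule LIMSEQ_le_const2[OF clip_lim[OF that]])
      have "(\<integral>t. clip R t ^ (2 * k) \<partial>K n) \<le> m (2 * k)" if "n \<ge> 2 * k" for n
      proof -
        have "(\<integral>t. clip R t ^ (2 * k) \<partial>K n) \<le> (\<integral>t. t ^ (2 * k) \<partial>K n)"
        proof (rule integral_mono)
          show "integrable (K n) (\<lambda>t. clip R t ^ (2 * k))"
            by (rule real_distribution.integrable_clip_power[OF K_dist \<open>R \<ge> 0\<close>])
          show "integrable (K n) (\<lambda>t. t ^ (2 * k))" using K_int that by blast
          show "clip R t ^ (2 * k) \<le> t ^ (2 * k)" for t
            using power_mono[OF abs_clip_le[OF \<open>R \<ge> 0\<close>], of t "2 * k"] by (simp add: power_mult)
        qed
        thus ?thesis using K_int that by simp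
      qed
      thus "\<exists>N. \<forall>n\<ge>N. (\<integral>t. clip R t ^ (2 * k) \<partial>K n) \<le> m (2 * k)" by blast
    qed
    \<comment> \<open>Clipping at level 0 serves only to show \<open>m (2 * k)\<close> nonnegative,
      so that passing to \<open>ennreal\<close> loses nothing.\<close>
    have "0 \<le> (\<integral>t. clip 0 t ^ (2 * k) \<partial>N)"
      by (intro integral_nonneg_AE AE_I2) (simp add: power_mult)
    hence m0: "m (2 * k) \<ge> 0"
      using clip_le[of 0] by linarith
    have "(\<integral>\<^sup>+t. ennreal (t ^ (2 * k)) \<partial>N) =
        (\<integral>\<^sup>+t. liminf (\<lambda>i. ennreal (clip (real i) t ^ (2 * k))) \<partial>N)"
    proof (rule nn_integral_cong)
      fix t
      have "\<forall>\<^sub>F i in sequentially. ennreal (clip (real i) t ^ (2 * k)) = ennreal (t ^ (2 * k))"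
        using eventually_ge_at_top[of "nat \<lceil>\<bar>t\<bar>\<rceil>"]
        by (rule eventually_mono) (simp add: clip_eq nat_le_iff ceiling_le_iff)
      hence "(\<lambda>i. ennreal (clip (real i) t ^ (2 * k))) \<longlonglongrightarrow> ennreal (t ^ (2 * k))"
        by (rule tendsto_eventually)
      thus "ennreal (t ^ (2 * k)) = liminf (\<lambda>i. ennreal (clip (real i) t ^ (2 * k)))"
        by (intro lim_imp_Liminf[symmetric]) auto
    qed
    also have "\<dots> \<le> liminf (\<lambda>i. \<integral>\<^sup>+t. ennreal (clip (real i) t ^ (2 * k)) \<partial>N)"
      by (intro nn_integral_liminf) simp
    also have "\<dots> \<le> liminf (\<lambda>i. ennreal (m (2 * k)))"
    proof (intro Liminf_mono always_eventually allI)
      fix i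
      have "(\<integral>\<^sup>+t. ennreal (clip (real i) t ^ (2 * k)) \<partial>N) = ennreal (\<integral>t. clip (real i) t ^ (2 * k) \<partial>N)"
        by (intro nn_integral_eq_integral N.integrable_clip_power) (auto simp: power_mult)
      also have "\<dots> \<le> ennreal (m (2 * k))" by (intro ennreal_leI clip_le) simp
      finally show "(\<integral>\<^sup>+t. ennreal (clip (real i) t ^ (2 * k)) \<partial>N) \<le> ennreal (m (2 * k))" .
    qed
    finally have le: "(\<integral>\<^sup>+t. ennreal (t ^ (2 * k)) \<partial>N) \<le> ennreal (m (2 * k))"
      by (simp add: Liminf_const)
    show *: "integrable N (\<lambda>t. t ^ (2 * k))"
      using le by (intro integrableI_nonneg) (auto simp: power_mult intro: le_less_trans)
    show "(\<integral>t. t ^ (2 * k) \<partial>N) \<le> m (2 * k)"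
      using le m0 nn_integral_eq_integral[OF *] by (simp add: power_mult)
  qed
  have N_int: "integrable N (\<lambda>t. t ^ k)" for k
  proof (rule Bochner_Integration.integrable_bound)
    show "integrable N (\<lambda>t. 1 + t ^ (2 * k))" using even_int by simp
    have "\<bar>t ^ k\<bar> \<le> 1 + t ^ (2 * k)" for t :: real
    proof -
      have "2 * \<bar>t ^ k\<bar> * 1 \<le> \<bar>t ^ k\<bar>\<^sup>2 + 1\<^sup>2" by (rule sum_squares_bound)
      moreover have "\<bar>t ^ k\<bar>\<^sup>2 = t ^ (2 * k)" by (simp add: power_even_eq)
      ultimately show ?thesis using abs_ge_zero[of "t ^ k"] by simp
    qed
    thus "AE t in N. norm (t ^ k) \<le> norm (1 + t ^ (2 * k))"
      by (intro AE_I2) (metis abs_ge_self order_trans real_norm_def)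
  qed simp
  have "(\<integral>t. t ^ k \<partial>N) = m k" for k
  proof (rule ccontr)
    let ?C = "2 * m (2 * (k + 1))"
    assume "(\<integral>t. t ^ k \<partial>N) \<noteq> m k"
    hence d: "\<bar>(\<integral>t. t ^ k \<partial>N) - m k\<bar> > 0" by simp
    \<comment> \<open>The moments of \<open>N\<close> and of \<open>K n\<close> both differ from
      their clipped versions by at most \<open>?C / R\<close>, uniformly in \<open>n\<close>. The
      \<open>R\<close> chosen afterwards makes the total at most half of the assumed
      discrepancy.\<close>
    have bound: "\<bar>(\<integral>t. t ^ k \<partial>N) - m k\<bar> \<le> 2 * (?C / R)" if "R \<ge> 1" for R
    proof -
      have 1: "\<bar>(\<integral>t. t ^ k \<partial>N) - (\<integral>t. clip R t ^ k \<partial>N)\<bar> \<le> ?C / R"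
      proof -
        have "\<bar>(\<integral>t. t ^ k \<partial>N) - (\<integral>t. clip R t ^ k \<partial>N)\<bar> \<le> 2 * (\<integral>t. t ^ (2 * k + 2) \<partial>N) / R"
          by (rule N.expectation_clip_power_error[OF that N_int N_int])
        also have "\<dots> \<le> ?C / R"
          using even_le[of "k + 1"] that by (intro divide_right_mono) auto
        finally show ?thesis .
      qed
      have "(\<lambda>n. \<bar>m k - (\<integral>t. clip R t ^ k \<partial>K n)\<bar>) \<longlonglongrightarrow> \<bar>m k - (\<integral>t. clip R t ^ k \<partial>N)\<bar>"
        using that by (intro tendsto_intros clip_lim) auto
      moreover have "\<bar>m k - (\<integral>t. clip R t ^ k \<partial>K n)\<bar> \<le> ?C / R" if "n \<ge> 2 * k + 2" for n
        using real_distribution.expectation_clip_power_error[OF K_dist \<open>R \<ge> 1\<close>, of n k]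
          K_int[of k n] K_int[of "2 * k + 2" n] that by simp
      ultimately have "\<bar>m k - (\<integral>t. clip R t ^ k \<partial>N)\<bar> \<le> ?C / R"
        by (intro LIMSEQ_le_const2) auto
      thus ?thesis using 1 by linarith
    qed
    define R where "R = max 1 (4 * ?C / \<bar>(\<integral>t. t ^ k \<partial>N) - m k\<bar>)"
    have "4 * ?C \<le> R * \<bar>(\<integral>t. t ^ k \<partial>N) - m k\<bar>" and R1: "R \<ge> 1"
      using d by (auto simp: R_def field_simps max_def)
    hence "2 * (?C / R) \<le> \<bar>(\<integral>t. t ^ k \<partial>N) - m k\<bar> / 2" by (simp add: field_simps)
    from order_trans[OF bound[OF R1] this] d show False by simp
  qed
  thus thesis using that N N_int by (auto simp: has_bochner_integral_iff)
qed

lemma finite_real_distribution: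
  assumes "finite R" "\<And>x. x \<in> R \<Longrightarrow> w x \<ge> 0" "(\<Sum>x\<in>R. w x) = 1"
  obtains M where "real_distribution M"
    "\<And>f::real \<Rightarrow> real. f \<in> borel_measurable borel \<Longrightarrow> has_bochner_integral M f (\<Sum>x\<in>R. w x * f x)"
proof -
  define g where "g x = (if x \<in> R then w x else 0)" for x
  have "(\<integral>\<^sup>+x. ennreal (g x) \<partial>count_space UNIV) = (\<Sum>x\<in>R. ennreal (g x))"
    by (rule nn_integral_count_space') (auto simp: g_def assms)
  also have "\<dots> = ennreal (\<Sum>x\<in>R. g x)"
    by (rule sum_ennreal) (auto simp: g_def assms)
  also have "(\<Sum>x\<in>R. g x) = 1" using assms by (simp add: g_def)
  finally have g: "(\<integral>\<^sup>+x. ennreal (g x) \<partial>count_space UNIV) = 1" by simp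
  define q where "q = embed_pmf g"
  have g0: "g x \<ge> 0" for x using assms by (simp add: g_def)
  have pmf_q: "pmf q x = g x" for x
    unfolding q_def using g0 g by (rule pmf_embed_pmf)
  have supp: "set_pmf q \<subseteq> R" by (auto simp: set_pmf_eq pmf_q g_def)
  \<comment> \<open>The image under the identity only replaces the discrete sigma-algebra by the
    Borel one.\<close>
  define M where "M = distr (measure_pmf q) borel (\<lambda>x. x)"
  have "real_distribution M"
    unfolding M_def by (rule prob_space.real_distribution_distr) (auto intro: prob_space_measure_pmf)
  moreover have "has_bochner_integral M f (\<Sum>x\<in>R. w x * f x)"
    if f: "f \<in> borel_measurable borel" for f :: "real \<Rightarrow> real"
  proof -
    have "has_bochner_integral (measure_pmf q) f (\<Sum>x\<in>R. w x * f x)"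
      unfolding has_bochner_integral_iff
    proof
      show "integrable (measure_pmf q) f"
        using supp assms(1) by (intro integrable_measure_pmf_finite) (rule finite_subset)
      have "(\<integral>x. f x \<partial>measure_pmf q) = (\<Sum>x\<in>R. f x * pmf q x)"
        using supp assms(1) by (intro integral_measure_pmf_real) auto
      thus "(\<integral>x. f x \<partial>measure_pmf q) = (\<Sum>x\<in>R. w x * f x)"
        by (simp add: pmf_q g_def mult.commute cong: sum.cong)
    qed
    thus ?thesis
      unfolding M_def using f by (simp add: has_bochner_integral_iff integrable_distr_eq integral_distr)
  qed
  ultimately show thesis using that by blast
qed

text \<open>Gauss rules divided by \<open>s 0\<close> are probability measures matching ever more
  moments; their weak limit matches all and is rescaled by the constant density
  \<open>s 0\<close>.\<close>

theorem (in positive_hankel) moment_solution_exists: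
  obtains \<rho> where "moment_solution s \<rho>"
proof -
  have s0: "s 0 > 0"
    using L_square_pos[of 1] by (simp add: moment_functional_def)
  have "\<exists>M. real_distribution M \<and> (\<forall>k\<le>n. has_bochner_integral M (\<lambda>t. t ^ k) (s k / s 0))" for n
  proof -
    obtain R w where R: "finite R" "\<And>x. x \<in> R \<Longrightarrow> w x > 0"
      and quad: "\<And>p. degree p < 2 * Suc n \<Longrightarrow> L p = (\<Sum>x\<in>R. w x * poly p x)"
      using gauss_quadrature[of "Suc n"] by blast
    have mom: "s k = (\<Sum>x\<in>R. w x * x ^ k)" if "k \<le> n" for k
    proof -
      have "L (monom 1 k) = s k"
        using moment_functional_monom_mult[of s 1 k 1] by (simp add: moment_functional_def)
      thus ?thesis
        using quad[of "monom 1 k"] that by (simp add: degree_monom_eq poly_monom)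
    qed
    have tot: "(\<Sum>x\<in>R. w x / s 0) = 1"
      using mom[of 0] s0 by (simp flip: sum_divide_distrib)
    obtain M where M: "real_distribution M" "\<And>f::real \<Rightarrow> real. f \<in> borel_measurable borel \<Longrightarrow>
        has_bochner_integral M f (\<Sum>x\<in>R. w x / s 0 * f x)"
      using finite_real_distribution[OF R(1) _ tot] R(2) s0 by (metis divide_nonneg_pos less_imp_le)
    have "has_bochner_integral M (\<lambda>t. t ^ k) (s k / s 0)" if "k \<le> n" for k
      using M(2)[of "\<lambda>t. t ^ k"] mom[OF that] by (simp add: sum_divide_distrib)
    thus ?thesis using M(1) by blast
  qed
  then obtain M where M: "\<And>n. real_distribution (M n)"
    "\<And>n k. k \<le> n \<Longrightarrow> has_bochner_integral (M n) (\<lambda>t. t ^ k) (s k / s 0)" by metis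
  obtain N where N: "real_distribution N" "\<And>k. has_bochner_integral N (\<lambda>t. t ^ k) (s k / s 0)"
    by (rule moment_limit[OF M]) auto
  interpret N: real_distribution N by (rule N)
  have "has_bochner_integral (density N (\<lambda>_. ennreal (s 0))) (\<lambda>t. t ^ k) (s k)" for k
    using has_bochner_integral_mult_right[of "s 0", OF N(2)[of k]] s0
    by (intro has_bochner_integral_density) auto
  hence "moment_solution s (density N (\<lambda>_. ennreal (s 0)))"
    by (auto simp: moment_solution_def)
  thus thesis by (rule that)
qed

section \<open>Poisson kernels determine finite measures\<close>

lemma borel_measurable_if_sets:
  assumes "sets M = sets borel" "f \<in> borel_measurable borel"
  shows "f \<in> borel_measurable M"
  using assms measurable_cong_sets[OF assms(1) refl] by blast

lemma nn_integral_Poisson_kernel: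
  fixes a b t y :: real
  assumes "a \<le> b" "y > 0"
  shows "(\<integral>\<^sup>+x. ennreal (y / ((t - x)\<^sup>2 + y\<^sup>2)) * indicator {a..b} x \<partial>lborel) =
           ennreal (arctan ((b - t) / y) - arctan ((a - t) / y))"
proof (rule nn_integral_FTC_Icc)
  fix x :: real
  have "(t - x)\<^sup>2 + y\<^sup>2 > 0" using assms by (simp add: sum_power2_gt_zero_iff)
  thus "0 \<le> y / ((t - x)\<^sup>2 + y\<^sup>2)" using assms by simp
  have "((\<lambda>x. arctan ((x - t) / y)) has_real_derivative (1 / y) * inverse (1 + ((x - t) / y)\<^sup>2)) (at x)"
    using assms by (auto intro!: derivative_eq_intros)
  moreover have "(1 / y) * inverse (1 + ((x - t) / y)\<^sup>2) = y / ((t - x)\<^sup>2 + y\<^sup>2)"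
  proof -
    have "1 + ((x - t) / y)\<^sup>2 = ((t - x)\<^sup>2 + y\<^sup>2) / y\<^sup>2"
      using assms by (simp add: power_divide add_divide_distrib power2_commute)
    thus ?thesis using assms by (simp add: power2_eq_square)
  qed
  ultimately have "((\<lambda>x. arctan ((x - t) / y)) has_real_derivative y / ((t - x)\<^sup>2 + y\<^sup>2)) (at x)"
    by simp
  thus "((\<lambda>x. arctan ((x - t) / y)) has_real_derivative y / ((t - x)\<^sup>2 + y\<^sup>2)) (at x)" .
qed (use assms in auto)

text \<open>The width 1/(n+1)^2 shrinks faster than the shift 1/(n+1) of the right endpoint, so the
  point \<open>t = b\<close> gets the full value pi instead of pi/2. The left endpoint runs to minus
  infinity.\<close>

lemma arctan_kernel_tendsto:
  fixes b t :: real
  shows "(\<lambda>n. arctan ((b + 1 / real (Suc n) - t) / (1 / (real (Suc n))\<^sup>2))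
           - arctan ((- real (Suc n) - t) / (1 / (real (Suc n))\<^sup>2)))
         \<longlonglongrightarrow> pi * indicator {..b} t"
proof -
  have lim_left: "(\<lambda>n. arctan ((- real (Suc n) - t) / (1 / (real (Suc n))\<^sup>2))) \<longlonglongrightarrow> - (pi / 2)"
    by (rule filterlim_compose[OF tendsto_arctan_at_bot]) real_asymp
  show ?thesis
  proof (cases "t \<le> b")
    case True
    have "filterlim (\<lambda>n. (b + 1 / real (Suc n) - t) / (1 / (real (Suc n))\<^sup>2)) at_top sequentially"
    proof (rule filterlim_at_top_mono)
      show "filterlim (\<lambda>n. real (Suc n)) at_top sequentially" by real_asymp
      show "\<forall>\<^sub>F n in sequentially. real (Suc n) \<le> (b + 1 / real (Suc n) - t) / (1 / (real (Suc n))\<^sup>2)"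
      proof (intro always_eventually allI)
        fix n
        have "0 \<le> (b - t) * (real (Suc n))\<^sup>2" using True by simp
        moreover have "(b + 1 / real (Suc n) - t) / (1 / (real (Suc n))\<^sup>2)
            = (b - t) * (real (Suc n))\<^sup>2 + real (Suc n)"
          by (simp add: power2_eq_square field_simps del: of_nat_Suc)
        ultimately show "real (Suc n) \<le> (b + 1 / real (Suc n) - t) / (1 / (real (Suc n))\<^sup>2)"
          by linarith
      qed
    qed
    hence "(\<lambda>n. arctan ((b + 1 / real (Suc n) - t) / (1 / (real (Suc n))\<^sup>2))) \<longlonglongrightarrow> pi / 2"
      by (rule filterlim_compose[OF tendsto_arctan_at_top])
    from tendsto_diff[OF this lim_left] True show ?thesis by simp
  next
    case False
    define c where "c = b - t"
    have "c < 0" using False by (simp add: c_def)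
    hence "filterlim (\<lambda>n. (c + 1 / real (Suc n)) / (1 / (real (Suc n))\<^sup>2)) at_bot sequentially"
      by real_asymp
    hence "(\<lambda>n. arctan ((b + 1 / real (Suc n) - t) / (1 / (real (Suc n))\<^sup>2))) \<longlonglongrightarrow> - (pi / 2)"
      by (intro filterlim_compose[OF tendsto_arctan_at_bot]) (simp add: c_def algebra_simps)
    from tendsto_diff[OF this lim_left] False show ?thesis by simp
  qed
qed

lemma arctan_diff_bounds:
  fixes u v :: real
  assumes "u \<le> v"
  shows "0 \<le> arctan v - arctan u" "arctan v - arctan u \<le> pi"
  using assms arctan_le_iff[of u v] arctan_bounded[of u] arctan_bounded[of v] by auto

lemma Poisson_kernel_bounds:
  fixes t x y :: real
  assumes "y > 0"
  shows "0 \<le> y / ((t - x)\<^sup>2 + y\<^sup>2)" "y / ((t - x)\<^sup>2 + y\<^sup>2) \<le> 1 / y"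
proof -
  show "0 \<le> y / ((t - x)\<^sup>2 + y\<^sup>2)" using assms by simp
  have "y / ((t - x)\<^sup>2 + y\<^sup>2) \<le> y / y\<^sup>2"
    using assms by (intro divide_left_mono) (auto intro!: mult_pos_pos add_nonneg_pos)
  thus "y / ((t - x)\<^sup>2 + y\<^sup>2) \<le> 1 / y" using assms by (simp add: power2_eq_square)
qed

context
  fixes \<mu> :: "real measure"
  assumes finite_\<mu>: "finite_measure \<mu>" and sets_\<mu>: "sets \<mu> = sets borel"
begin

interpretation finite_measure \<mu> by (rule finite_\<mu>)

text \<open>Fubini's theorem: integrating the Poisson kernel first over [a,b] gives the arctangents,
  so their integral is determined by the Poisson integrals of \<mu>.\<close>

lemma nn_integral_arctan_kernel:
  assumes "a \<le> b" "y > 0"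
  shows "(\<integral>\<^sup>+t. ennreal (arctan ((b - t) / y) - arctan ((a - t) / y)) \<partial>\<mu>) =
    (\<integral>\<^sup>+x. ennreal (\<integral>t. y / ((t - x)\<^sup>2 + y\<^sup>2) \<partial>\<mu>) * indicator {a..b} x \<partial>lborel)"
proof -
  interpret pair_sigma_finite lborel \<mu>
    by (intro pair_sigma_finite.intro sigma_finite_lborel sigma_finite_measure_axioms)
  have int: "integrable \<mu> (\<lambda>t. y / ((t - x)\<^sup>2 + y\<^sup>2))" for x
    using Poisson_kernel_bounds[OF assms(2)]
    by (intro integrable_const_bound[of _ "1 / y"] borel_measurable_if_sets[OF sets_\<mu>] AE_I2)
       (auto simp del: abs_divide)
  have "(\<integral>\<^sup>+t. ennreal (arctan ((b - t) / y) - arctan ((a - t) / y)) \<partial>\<mu>) =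
      (\<integral>\<^sup>+t. (\<integral>\<^sup>+x. ennreal (y / ((t - x)\<^sup>2 + y\<^sup>2)) * indicator {a..b} x \<partial>lborel) \<partial>\<mu>)"
    by (simp add: nn_integral_Poisson_kernel[OF assms])
  also have "\<dots> = (\<integral>\<^sup>+x. (\<integral>\<^sup>+t. ennreal (y / ((t - x)\<^sup>2 + y\<^sup>2)) * indicator {a..b} x \<partial>\<mu>) \<partial>lborel)"
  proof (rule Fubini')
    have "(\<lambda>p. ennreal (y / ((snd p - fst p)\<^sup>2 + y\<^sup>2)) * indicator {a..b} (fst p))
        \<in> borel_measurable (borel \<Otimes>\<^sub>M borel)" by measurable
    thus "(\<lambda>(x, t). ennreal (y / ((t - x)\<^sup>2 + y\<^sup>2)) * indicator {a..b} x)
        \<in> borel_measurable (lborel \<Otimes>\<^sub>M \<mu>)"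
      by (simp add: case_prod_beta measurable_cong_sets[OF sets_pair_measure_cong[OF sets_lborel sets_\<mu>] refl])
  qed
  also have "\<dots> = (\<integral>\<^sup>+x. ennreal (\<integral>t. y / ((t - x)\<^sup>2 + y\<^sup>2) \<partial>\<mu>) * indicator {a..b} x \<partial>lborel)"
    using Poisson_kernel_bounds[OF assms(2)] int
    by (intro nn_integral_cong)
       (simp add: nn_integral_multc nn_integral_eq_integral borel_measurable_if_sets[OF sets_\<mu>])
  finally show ?thesis .
qed

lemma measure_atMost_limit_arctan_kernel:
  "(\<lambda>n. \<integral>t. arctan ((b + 1 / real (Suc n) - t) / (1 / (real (Suc n))\<^sup>2))
           - arctan ((- real (Suc n) - t) / (1 / (real (Suc n))\<^sup>2)) \<partial>\<mu>)
     \<longlonglongrightarrow> pi * measure \<mu> {..b}"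
proof -
  have "(\<lambda>n. \<integral>t. arctan ((b + 1 / real (Suc n) - t) / (1 / (real (Suc n))\<^sup>2))
           - arctan ((- real (Suc n) - t) / (1 / (real (Suc n))\<^sup>2)) \<partial>\<mu>)
     \<longlonglongrightarrow> (\<integral>t. pi * indicator {..b} t \<partial>\<mu>)"
  proof (rule integral_dominated_convergence[where w = "\<lambda>_. pi"])
    show "AE t in \<mu>. (\<lambda>n. arctan ((b + 1 / real (Suc n) - t) / (1 / (real (Suc n))\<^sup>2))
           - arctan ((- real (Suc n) - t) / (1 / (real (Suc n))\<^sup>2))) \<longlonglongrightarrow> pi * indicator {..b} t"
      using arctan_kernel_tendsto by (intro AE_I2)
    show "AE t in \<mu>. norm (arctan ((b + 1 / real (Suc n) - t) / (1 / (real (Suc n))\<^sup>2))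
           - arctan ((- real (Suc n) - t) / (1 / (real (Suc n))\<^sup>2))) \<le> pi" for n
    proof (intro AE_I2)
      fix t
      show "norm (arctan ((b + 1 / real (Suc n) - t) / (1 / (real (Suc n))\<^sup>2))
           - arctan ((- real (Suc n) - t) / (1 / (real (Suc n))\<^sup>2))) \<le> pi"
        using arctan_bounded[of "(b + 1 / real (Suc n) - t) / (1 / (real (Suc n))\<^sup>2)"]
          arctan_bounded[of "(- real (Suc n) - t) / (1 / (real (Suc n))\<^sup>2)"]
        unfolding real_norm_def by linarith
    qed
  qed (auto intro!: borel_measurable_if_sets[OF sets_\<mu>])
  thus ?thesis using sets_\<mu> by simp
qed

end

text \<open>Stieltjes inversion: Poisson integrals determine the arctangent integrals, whose limits
  are the masses of the half-lines, and these generate the Borel sets.\<close>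

lemma finite_measure_eqI_Poisson:
  fixes \<mu> \<nu> :: "real measure"
  assumes fin: "finite_measure \<mu>" "finite_measure \<nu>"
    and sets: "sets \<mu> = sets borel" "sets \<nu> = sets borel"
    and eq: "\<And>x y. y > 0 \<Longrightarrow> (\<integral>t. y / ((t - x)\<^sup>2 + y\<^sup>2) \<partial>\<mu>) = (\<integral>t. y / ((t - x)\<^sup>2 + y\<^sup>2) \<partial>\<nu>)"
  shows "\<mu> = \<nu>"
proof -
  have int_eq: "(\<integral>t. arctan ((b - t) / y) - arctan ((a - t) / y) \<partial>\<mu>) =
      (\<integral>t. arctan ((b - t) / y) - arctan ((a - t) / y) \<partial>\<nu>)" if "a \<le> b" "y > 0" for a b y
  proof -
    have nn: "0 \<le> arctan ((b - t) / y) - arctan ((a - t) / y)" for t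
      using that by (intro arctan_diff_bounds divide_right_mono) auto
    have "(\<integral>t. arctan ((b - t) / y) - arctan ((a - t) / y) \<partial>M) =
        enn2real (\<integral>\<^sup>+t. ennreal (arctan ((b - t) / y) - arctan ((a - t) / y)) \<partial>M)"
      if "sets M = sets borel" for M
    proof (rule integral_eq_nn_integral)
      show "(\<lambda>t. arctan ((b - t) / y) - arctan ((a - t) / y)) \<in> borel_measurable M"
        by (rule borel_measurable_if_sets[OF that]) measurable
    qed (use nn in auto)
    thus ?thesis
      using nn_integral_arctan_kernel[OF fin(1) sets(1) that] eq[OF that(2)]
        nn_integral_arctan_kernel[OF fin(2) sets(2) that] sets by simp
  qed
  have meas_eq: "measure \<mu> {..b} = measure \<nu> {..b}" for b
  proof -
    have "\<forall>\<^sub>F n in sequentially. - real (Suc n) \<le> b + 1 / real (Suc n)" by real_asymp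
    hence ev: "\<forall>\<^sub>F n in sequentially.
      (\<integral>t. arctan ((b + 1 / real (Suc n) - t) / (1 / (real (Suc n))\<^sup>2))
           - arctan ((- real (Suc n) - t) / (1 / (real (Suc n))\<^sup>2)) \<partial>\<mu>) =
      (\<integral>t. arctan ((b + 1 / real (Suc n) - t) / (1 / (real (Suc n))\<^sup>2))
           - arctan ((- real (Suc n) - t) / (1 / (real (Suc n))\<^sup>2)) \<partial>\<nu>)"
      by (rule eventually_mono) (intro int_eq, auto)
    have "pi * measure \<mu> {..b} = pi * measure \<nu> {..b}"
      using measure_atMost_limit_arctan_kernel[OF fin(1) sets(1), of b]
        measure_atMost_limit_arctan_kernel[OF fin(2) sets(2), of b]
      unfolding tendsto_cong[OF ev] by (rule LIMSEQ_unique)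
    thus ?thesis by simp
  qed
  interpret M: finite_measure \<mu> by (rule fin)
  interpret N: finite_measure \<nu> by (rule fin)
  show ?thesis
  proof (rule measure_eqI_generator_eq[where E = "range (\<lambda>a::real. {..a})" and \<Omega> = UNIV
        and A = "\<lambda>n. {..real n}"])
    show "Int_stable (range (\<lambda>a::real. {..a}))"
      by (auto simp: Int_stable_def)
    show "emeasure \<mu> X = emeasure \<nu> X" if "X \<in> range (\<lambda>a. {..a})" for X
      using that meas_eq by (auto simp: M.emeasure_eq_measure N.emeasure_eq_measure)
    show "sets \<mu> = sigma_sets UNIV (range (\<lambda>a. {..a}))" "sets \<nu> = sigma_sets UNIV (range (\<lambda>a. {..a}))"
      unfolding sets borel_eq_atMost by auto
    show "(\<Union>i. {..real i}) = UNIV" by (auto intro: real_arch_simple)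
  qed auto
qed

section \<open>Hamburger's criterion\<close>

lemma moment_solution_finite_measure:
  assumes "moment_solution s \<rho>"
  shows "finite_measure \<rho>"
proof
  have "integrable \<rho> (\<lambda>t. t ^ 0)"
    using assms unfolding moment_solution_def has_bochner_integral_iff by blast
  thus "emeasure \<rho> (space \<rho>) \<noteq> \<infinity>"
    by (simp add: integrable_iff_bounded less_top)
qed

lemma has_bochner_integral_poly:
  assumes "moment_solution s \<rho>"
  shows "has_bochner_integral \<rho> (poly p) (moment_functional s p)"
proof -
  have "has_bochner_integral \<rho> (\<lambda>t. t ^ k) (s k)" for k
    using assms by (simp add: moment_solution_def)
  hence "has_bochner_integral \<rho> (\<lambda>t. \<Sum>i\<le>degree p. coeff p i * t ^ i) (\<Sum>i\<le>degree p. coeff p i * s i)"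
    by (intro has_bochner_integral_sum has_bochner_integral_mult_right)
  thus ?thesis
    by (simp add: moment_functional_def poly_altdef[abs_def])
qed

text \<open>The kernel is the real part of 1/(t - z) with z = x + iy; the bound is the inequality
  between arithmetic and geometric mean.\<close>

lemma conjugate_kernel_bound:
  fixes t x y :: real
  assumes y: "y > 0"
  shows "\<bar>(t - x) / ((t - x)\<^sup>2 + y\<^sup>2)\<bar> \<le> 1 / y"
proof -
  have "2 * \<bar>t - x\<bar> * y \<le> (t - x)\<^sup>2 + y\<^sup>2"
    using sum_squares_bound[of "\<bar>t - x\<bar>" y] by simp
  moreover have "\<bar>t - x\<bar> * y \<ge> 0" using y by simp
  ultimately have "\<bar>t - x\<bar> * y \<le> (t - x)\<^sup>2 + y\<^sup>2" by linarith
  moreover have "(t - x)\<^sup>2 + y\<^sup>2 > 0" using y by (simp add: add_nonneg_pos)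
  ultimately show ?thesis using y by (simp add: field_simps)
qed

text \<open>The sum measure is realised as an image of a measure on \<open>\<real> \<times> bool\<close>.\<close>
lemma add_point_mass:
  fixes \<nu> :: "real measure" and x c :: real
  assumes fin: "finite_measure \<nu>" and sets: "sets \<nu> = sets borel"
    and pos: "measure \<nu> UNIV > 0" and c: "c \<ge> 0"
  obtains \<rho> where "sets \<rho> = sets borel"
    "\<And>f. f \<in> borel_measurable borel \<Longrightarrow> (\<integral>\<^sup>+t. f t \<partial>\<rho>) = (\<integral>\<^sup>+t. f t \<partial>\<nu>) + ennreal c * f x"
proof -
  interpret finite_measure \<nu> by (rule fin)
  define m where "m = measure \<nu> UNIV"
  \<comment> \<open>The copy of \<nu> flagged \<open>True\<close> is weighted to total mass
    \<open>c\<close> and collapsed by \<open>h\<close> onto \<open>x\<close>; the other copy is kept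
    as it is.\<close>
  define g :: "real \<times> bool \<Rightarrow> ennreal" where "g p = (if snd p then ennreal (c / m) else 1)" for p
  define h where "h p = (if snd p then x else fst p)" for p :: "real \<times> bool"
  define K where "K = \<nu> \<Otimes>\<^sub>M count_space (UNIV :: bool set)"
  define \<rho> where "\<rho> = distr (density K g) borel h"
  interpret B: sigma_finite_measure "count_space (UNIV :: bool set)"
    by (rule sigma_finite_measure_count_space_finite) simp
  have setsK: "sets K = sets (borel \<Otimes>\<^sub>M count_space UNIV)"
    unfolding K_def by (rule sets_pair_measure_cong[OF sets refl])
  have gm: "g \<in> borel_measurable K"
    unfolding measurable_cong_sets[OF setsK refl] g_def by measurable
  have hm: "h \<in> measurable K borel"
    unfolding measurable_cong_sets[OF setsK refl] h_def by measurable
  have sp: "space \<nu> = UNIV" using sets_eq_imp_space_eq[OF sets] by simp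
  have "(\<integral>\<^sup>+t. f t \<partial>\<rho>) = (\<integral>\<^sup>+t. f t \<partial>\<nu>) + ennreal c * f x"
    if f: "f \<in> borel_measurable borel" for f
  proof -
    have fh: "(\<lambda>p. f (h p)) \<in> borel_measurable K"
      using measurable_compose[OF hm f] .
    have f\<nu>: "f \<in> borel_measurable \<nu>" by (rule borel_measurable_if_sets[OF sets f])
    have "(\<integral>\<^sup>+t. f t \<partial>\<rho>) = (\<integral>\<^sup>+p. f (h p) \<partial>density K g)"
      unfolding \<rho>_def by (rule nn_integral_distr) (use hm f in simp_all)
    also have "\<dots> = (\<integral>\<^sup>+p. g p * f (h p) \<partial>K)"
      using gm fh by (intro nn_integral_density) auto
    also have "\<dots> = (\<integral>\<^sup>+t. (\<integral>\<^sup>+b. g (t, b) * f (h (t, b)) \<partial>count_space UNIV) \<partial>\<nu>)"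
      using gm fh unfolding K_def by (subst B.nn_integral_fst) auto
    also have "\<dots> = (\<integral>\<^sup>+t. f t + ennreal (c / m) * f x \<partial>\<nu>)"
      by (simp add: nn_integral_count_space_finite UNIV_bool g_def h_def add.commute)
    also have "\<dots> = (\<integral>\<^sup>+t. f t \<partial>\<nu>) + (ennreal (c / m) * f x) * emeasure \<nu> UNIV"
      using f\<nu> by (subst nn_integral_add) (auto simp: sp)
    also have "(ennreal (c / m) * f x) * emeasure \<nu> UNIV = ennreal (c / m * m) * f x"
      using c pos by (subst ennreal_mult) (auto simp: m_def emeasure_eq_measure mult_ac)
    also have "c / m * m = c" using pos by (simp add: m_def)
    finally show ?thesis .
  qed
  moreover have "sets \<rho> = sets borel" by (simp add: \<rho>_def)
  ultimately show thesis using that by blast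
qed

text \<open>Positive and negative parts are treated separately, since \<open>nn\<close> speaks of
  nonnegative integrals only.\<close>

lemma has_bochner_integral_add_point_mass:
  fixes f :: "real \<Rightarrow> real"
  assumes sets: "sets \<rho> = sets borel"
    and nn: "\<And>f. f \<in> borel_measurable borel \<Longrightarrow>
      (\<integral>\<^sup>+t. f t \<partial>\<rho>) = (\<integral>\<^sup>+t. f t \<partial>\<nu>) + ennreal c * f x"
    and c: "c \<ge> 0" and f: "f \<in> borel_measurable borel" and I: "has_bochner_integral \<nu> f I"
  shows "has_bochner_integral \<rho> f (I + c * f x)"
proof -
  have int: "integrable \<nu> f" and eq: "(\<integral>t. f t \<partial>\<nu>) = I"
    using I by (auto simp: has_bochner_integral_iff)
  have fin: "(\<integral>\<^sup>+t. ennreal (f t) \<partial>\<nu>) < \<infinity>" "(\<integral>\<^sup>+t. ennreal (- f t) \<partial>\<nu>) < \<infinity>"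
    using int by (auto simp: real_integrable_def less_top)
  have nf: "(\<integral>\<^sup>+t. ennreal (f t) \<partial>\<rho>) = (\<integral>\<^sup>+t. ennreal (f t) \<partial>\<nu>) + ennreal c * ennreal (f x)"
           "(\<integral>\<^sup>+t. ennreal (- f t) \<partial>\<rho>) = (\<integral>\<^sup>+t. ennreal (- f t) \<partial>\<nu>) + ennreal c * ennreal (- f x)"
    using nn[of "\<lambda>t. ennreal (f t)"] nn[of "\<lambda>t. ennreal (- f t)"] f by simp_all
  have int': "integrable \<rho> f"
    unfolding real_integrable_def nf using fin f
    by (auto intro: borel_measurable_if_sets[OF sets] simp: ennreal_mult_eq_top_iff less_top)
  have e: "enn2real (ennreal c * ennreal r) = c * max r 0" for r
    using c by (cases "r \<ge> 0") (auto simp: enn2real_mult ennreal_neg)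
  have "(\<integral>t. f t \<partial>\<rho>) = I + c * f x"
    unfolding real_lebesgue_integral_def[OF int'] nf eq[symmetric] real_lebesgue_integral_def[OF int]
    using fin by (subst (1 2) enn2real_plus) (auto simp: e ennreal_mult_less_top max_def algebra_simps)
  thus ?thesis using int' by (simp add: has_bochner_integral_iff)
qed

section \<open>A convergent series implies indeterminacy\<close>

context positive_hankel
begin

text \<open>By Cauchy-Schwarz in the orthonormal expansion, evaluation at \<open>x\<close> is
  bounded: (q(x))^2 \<le> S L(q^2). A mass below 1/S can therefore be removed from the functional
  and put back after solving the smaller problem.\<close>

lemma exists_solution_with_atom:
  assumes "summable (\<lambda>n. (poly (orthopoly n) x)\<^sup>2)"
  obtains \<rho> where "moment_solution s \<rho>" "measure \<rho> {x} \<noteq> 0"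
proof -
  define S where "S = (\<Sum>n. (poly (orthopoly n) x)\<^sup>2)"
  have "poly (orthopoly 0) x \<noteq> 0"
  proof -
    obtain d where d: "orthopoly 0 = [:d:]" using degree_orthopoly[of 0] degree_eq_zeroE by blast
    thus ?thesis using coeff_orthopoly_lead[of 0] by auto
  qed
  hence "S > 0"
    unfolding S_def using assms by (intro suminf_pos2[of _ 0]) auto
  have CS: "(poly q x)\<^sup>2 \<le> S * L (q * q)" for q
  proof -
    let ?N = "degree q"
    have "poly q x = (\<Sum>k\<le>?N. L (q * orthopoly k) * poly (orthopoly k) x)"
      by (subst (1) orthopoly_expansion[OF order_refl]) (simp add: poly_sum)
    hence "(poly q x)\<^sup>2 \<le> (\<Sum>k\<le>?N. (L (q * orthopoly k))\<^sup>2) * (\<Sum>k\<le>?N. (poly (orthopoly k) x)\<^sup>2)"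
      by (simp only: Cauchy_Schwarz_ineq_sum)
    also have "\<dots> \<le> L (q * q) * S"
    proof (rule mult_mono)
      show "(\<Sum>k\<le>?N. (poly (orthopoly k) x)\<^sup>2) \<le> S"
        unfolding S_def by (rule sum_le_suminf[OF assms]) auto
    qed (auto simp: L_square[of q ?N] intro!: sum_nonneg)
    finally show ?thesis by (simp add: mult.commute)
  qed
  \<comment> \<open>Half of the critical mass 1/S: at least half of \<open>L (q * q)\<close>
    survives, which keeps positivity strict.\<close>
  define c where "c = 1 / (2 * S)"
  have "c > 0" using \<open>S > 0\<close> by (simp add: c_def)
  define s' where "s' k = s k - c * x ^ k" for k
  have L': "moment_functional s' p = L p - c * poly p x" for p
    unfolding s'_def moment_functional_diff_seq moment_functional_power ..
  interpret S': positive_hankel s'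
  proof (rule positive_hankelI)
    fix q :: "real poly" assume "q \<noteq> 0"
    hence "L (q * q) > 0" by (rule L_square_pos)
    moreover have "c * (poly q x)\<^sup>2 \<le> c * (S * L (q * q))"
      using CS \<open>c > 0\<close> by (intro mult_left_mono) auto
    hence "c * (poly q x)\<^sup>2 \<le> L (q * q) / 2"
      using \<open>S > 0\<close> by (simp add: c_def)
    ultimately show "moment_functional s' (q * q) > 0"
      by (simp add: L' power2_eq_square)
  qed
  obtain \<nu> where \<nu>: "moment_solution s' \<nu>" by (rule S'.moment_solution_exists)
  have sets: "sets \<nu> = sets borel" using \<nu> by (simp add: moment_solution_def)
  have sp: "space \<nu> = UNIV" using sets_eq_imp_space_eq[OF sets] by simp
  have "measure \<nu> UNIV = s' 0"
    using \<nu> sp by (auto simp: moment_solution_def has_bochner_integral_iff dest!: spec[of _ 0])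
  moreover have "s' 0 > 0"
    using S'.L_square_pos[of 1] by (simp add: moment_functional_def)
  ultimately have pos: "measure \<nu> UNIV > 0" by simp
  obtain \<rho> where \<rho>: "sets \<rho> = sets borel" and nn: "\<And>f. f \<in> borel_measurable borel \<Longrightarrow>
      (\<integral>\<^sup>+t. f t \<partial>\<rho>) = (\<integral>\<^sup>+t. f t \<partial>\<nu>) + ennreal c * f x"
    using add_point_mass[OF moment_solution_finite_measure[OF \<nu>] sets pos, of c x] \<open>c > 0\<close>
    by (metis less_imp_le)
  have "has_bochner_integral \<rho> (\<lambda>t. t ^ k) (s' k + c * x ^ k)" for k
    using \<nu> \<open>c > 0\<close>
    by (intro has_bochner_integral_add_point_mass[OF \<rho> nn]) (auto simp: moment_solution_def)
  hence sol: "moment_solution s \<rho>"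
    using \<rho> by (simp add: moment_solution_def s'_def)
  interpret R: finite_measure \<rho> by (rule moment_solution_finite_measure[OF sol])
  have "ennreal c \<le> emeasure \<rho> {x}"
    using nn[of "indicator {x}"] \<rho> sets by (simp add: nn_integral_indicator)
  hence "measure \<rho> {x} \<noteq> 0"
    using \<open>c > 0\<close> by (auto simp: R.emeasure_eq_measure)
  with sol show thesis by (rule that)
qed

lemma not_determinate_if_summable:
  assumes P: "summable (\<lambda>n. (poly (orthopoly n) 0)\<^sup>2)" and Q: "summable (\<lambda>n. (second_kind n)\<^sup>2)"
  shows "\<not> moment_determinate s"
proof
  assume "moment_determinate s"
  then obtain \<mu> where \<mu>: "moment_solution s \<mu>" and uniq: "\<And>\<rho>. moment_solution s \<rho> \<Longrightarrow> \<rho> = \<mu>"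
    unfolding moment_determinate_def by auto
  interpret finite_measure \<mu> by (rule moment_solution_finite_measure[OF \<mu>])
  have "measure \<mu> {x} \<noteq> 0" for x
  proof -
    have "summable (\<lambda>n. (norm (poly (orthopoly n) x))\<^sup>2)"
      by (rule square_summable_jacobi_solution[OF jacobi_solution_orthopoly[of 0]
            jacobi_solution_second_kind jacobi_solution_orthopoly])
         (use P Q casoratian_orthopoly_second_kind[of 0] in simp_all)
    then obtain \<rho> where "moment_solution s \<rho>" "measure \<rho> {x} \<noteq> 0"
      using exists_solution_with_atom[of x] by auto
    thus ?thesis using uniq by blast
  qed
  hence "{x. measure \<mu> {x} \<noteq> 0} = UNIV" by auto
  with countable_support have "countable (UNIV :: real set)" by simp
  thus False using uncountable_UNIV_real by blast
qed

section \<open>Non-uniqueness implies a convergent series\<close>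

lemma Bessel_inequality:
  assumes \<mu>: "moment_solution s \<mu>"
    and h: "h \<in> borel_measurable borel" "\<And>t. \<bar>h t\<bar> \<le> C"
  shows "summable (\<lambda>k. (\<integral>t. poly (orthopoly k) t * h t \<partial>\<mu>)\<^sup>2)"
    and "integrable \<mu> (\<lambda>t. poly p t * h t)"
proof -
  interpret finite_measure \<mu> by (rule moment_solution_finite_measure[OF \<mu>])
  have sets: "sets \<mu> = sets borel" using \<mu> by (simp add: moment_solution_def)
  have "C \<ge> 0" using h(2)[of 0] by linarith
  have h\<mu>: "h \<in> borel_measurable \<mu>" by (rule borel_measurable_if_sets[OF sets h(1)])
  have int_poly: "integrable \<mu> (poly p)" "(\<integral>t. poly p t \<partial>\<mu>) = L p" for p
    using has_bochner_integral_poly[OF \<mu>, of p] by (auto simp: has_bochner_integral_iff)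
  show int_ph: "integrable \<mu> (\<lambda>t. poly p t * h t)" for p
  proof (rule Bochner_Integration.integrable_bound)
    show "integrable \<mu> (\<lambda>t. poly p t * C)" using int_poly by simp
    show "AE t in \<mu>. norm (poly p t * h t) \<le> norm (poly p t * C)"
      using h(2) \<open>C \<ge> 0\<close> by (intro AE_I2) (auto simp: abs_mult intro!: mult_left_mono)
  qed (use int_poly h\<mu> in auto)
  have int_hh: "integrable \<mu> (\<lambda>t. h t * h t)"
  proof (rule integrable_const_bound)
    show "AE t in \<mu>. norm (h t * h t) \<le> C * C"
      unfolding real_norm_def abs_mult
      using h(2) \<open>C \<ge> 0\<close> by (intro AE_I2 mult_mono) auto
  qed (use h\<mu> in auto)
  define c where "c k = (\<integral>t. poly (orthopoly k) t * h t \<partial>\<mu>)" for k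
  have "(\<Sum>k<n. (c k)\<^sup>2) \<le> (\<integral>t. h t * h t \<partial>\<mu>)" for n
  proof -
    define q where "q = (\<Sum>k<n. smult (c k) (orthopoly k))"
    have "(\<integral>t. poly q t * h t \<partial>\<mu>) = (\<integral>t. (\<Sum>k<n. c k * (poly (orthopoly k) t * h t)) \<partial>\<mu>)"
      by (simp add: q_def poly_sum sum_distrib_right mult.assoc)
    also have "\<dots> = (\<Sum>k<n. (c k)\<^sup>2)"
      using int_ph by (subst Bochner_Integration.integral_sum) (auto simp: c_def power2_eq_square)
    finally have qh: "(\<integral>t. poly q t * h t \<partial>\<mu>) = (\<Sum>k<n. (c k)\<^sup>2)" .
    have "L (q * orthopoly k) = c k" if "k < n" for k
    proof -
      have "L (q * orthopoly k) = (\<Sum>j<n. if j = k then c k else 0)"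
        unfolding q_def sum_distrib_right moment_functional_sum
        by (rule sum.cong) (auto simp: moment_functional_smult orthonormal)
      thus ?thesis using that by simp
    qed
    hence "L (q * q) = (\<Sum>k<n. (c k)\<^sup>2)"
      by (subst (2) q_def) (simp add: sum_distrib_left moment_functional_sum moment_functional_smult
          power2_eq_square)
    hence qq: "(\<integral>t. poly q t * poly q t \<partial>\<mu>) = (\<Sum>k<n. (c k)\<^sup>2)"
      using int_poly(2)[of "q * q"] by simp
    have "poly (q * q) = (\<lambda>t. poly q t * poly q t)" by (simp add: fun_eq_iff)
    hence int_qq: "integrable \<mu> (\<lambda>t. poly q t * poly q t)"
      using int_poly(1)[of "q * q"] by simp
    \<comment> \<open>With \<open>q\<close> the Fourier partial sum of \<open>h\<close>, the cross
      term and the square of \<open>q\<close> both integrate to the sum of the squared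
      coefficients.\<close>
    have "0 \<le> (\<integral>t. (h t - poly q t)\<^sup>2 \<partial>\<mu>)" by simp
    also have "\<dots> = (\<integral>t. h t * h t - 2 * (poly q t * h t) + poly q t * poly q t \<partial>\<mu>)"
      by (intro Bochner_Integration.integral_cong refl) (simp add: power2_eq_square algebra_simps)
    also have "\<dots> = (\<integral>t. h t * h t \<partial>\<mu>) - 2 * (\<Sum>k<n. (c k)\<^sup>2) + (\<Sum>k<n. (c k)\<^sup>2)"
      using int_ph[of q] int_hh int_qq qh qq by simp
    finally show ?thesis by simp
  qed
  thus "summable (\<lambda>k. (\<integral>t. poly (orthopoly k) t * h t \<partial>\<mu>)\<^sup>2)"
    unfolding c_def by (intro summableI_nonneg_bounded) auto
qed

text \<open>The integral of \<open>p(t) / (t - z)\<close> at \<open>z = x + i y\<close>, real and imaginary parts separately.\<close>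
definition cauchy_integral :: "real measure \<Rightarrow> real \<Rightarrow> real \<Rightarrow> real poly \<Rightarrow> complex" where
  "cauchy_integral \<mu> x y p =
     Complex (\<integral>t. poly p t * ((t - x) / ((t - x)\<^sup>2 + y\<^sup>2)) \<partial>\<mu>)
             (\<integral>t. poly p t * (y / ((t - x)\<^sup>2 + y\<^sup>2)) \<partial>\<mu>)"

context
  fixes \<mu> :: "real measure" and x y :: real
  assumes \<mu>: "moment_solution s \<mu>" and y: "y > (0::real)"
begin

lemma kernel_integrals:
  "integrable \<mu> (\<lambda>t. poly p t * ((t - x) / ((t - x)\<^sup>2 + y\<^sup>2)))"
  "integrable \<mu> (\<lambda>t. poly p t * (y / ((t - x)\<^sup>2 + y\<^sup>2)))"
  "summable (\<lambda>k. (\<integral>t. poly (orthopoly k) t * ((t - x) / ((t - x)\<^sup>2 + y\<^sup>2)) \<partial>\<mu>)\<^sup>2)"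
  "summable (\<lambda>k. (\<integral>t. poly (orthopoly k) t * (y / ((t - x)\<^sup>2 + y\<^sup>2)) \<partial>\<mu>)\<^sup>2)"
proof -
  have b2: "\<bar>y / ((t - x)\<^sup>2 + y\<^sup>2)\<bar> \<le> 1 / y" for t
    using Poisson_kernel_bounds[OF y, of t x] by linarith
  show "integrable \<mu> (\<lambda>t. poly p t * ((t - x) / ((t - x)\<^sup>2 + y\<^sup>2)))"
    "summable (\<lambda>k. (\<integral>t. poly (orthopoly k) t * ((t - x) / ((t - x)\<^sup>2 + y\<^sup>2)) \<partial>\<mu>)\<^sup>2)"
    by (rule Bessel_inequality[OF \<mu> _ conjugate_kernel_bound[OF y]]; measurable)+
  show "integrable \<mu> (\<lambda>t. poly p t * (y / ((t - x)\<^sup>2 + y\<^sup>2)))"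
    "summable (\<lambda>k. (\<integral>t. poly (orthopoly k) t * (y / ((t - x)\<^sup>2 + y\<^sup>2)) \<partial>\<mu>)\<^sup>2)"
    by (rule Bessel_inequality[OF \<mu> _ b2]; measurable)+
qed

lemma summable_cauchy_integral: "summable (\<lambda>k. (norm (cauchy_integral \<mu> x y (orthopoly k)))\<^sup>2)"
  unfolding cauchy_integral_def cmod_power2 complex.sel
  by (intro summable_add kernel_integrals)

lemma cauchy_integral_add:
  "cauchy_integral \<mu> x y (p + q) = cauchy_integral \<mu> x y p + cauchy_integral \<mu> x y q"
  using kernel_integrals(1,2)[of p] kernel_integrals(1,2)[of q]
  by (simp add: cauchy_integral_def complex_eq_iff distrib_right add_divide_distrib)

lemma cauchy_integral_smult:
  "cauchy_integral \<mu> x y (smult c p) = complex_of_real c * cauchy_integral \<mu> x y p"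
  by (simp add: cauchy_integral_def complex_eq_iff mult.assoc del: times_divide_eq_right)

text \<open>This is \<open>t / (t - z) = z / (t - z) + 1\<close>.\<close>
lemma cauchy_integral_pCons:
  "cauchy_integral \<mu> x y (pCons 0 p) =
     Complex x y * cauchy_integral \<mu> x y p + complex_of_real (L p)"
proof -
  have int: "integrable \<mu> (poly p)" "(\<integral>t. poly p t \<partial>\<mu>) = L p"
    using has_bochner_integral_poly[OF \<mu>, of p] by (auto simp: has_bochner_integral_iff)
  have pos: "(t - x)\<^sup>2 + y\<^sup>2 \<noteq> 0" for t using y by (simp add: sum_power2_eq_zero_iff)
  have e1: "poly (pCons 0 p) t * ((t - x) / ((t - x)\<^sup>2 + y\<^sup>2)) =
      x * (poly p t * ((t - x) / ((t - x)\<^sup>2 + y\<^sup>2))) - y * (poly p t * (y / ((t - x)\<^sup>2 + y\<^sup>2))) + poly p t" for t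
  proof -
    have "t * ((t - x) / ((t - x)\<^sup>2 + y\<^sup>2)) = x * ((t - x) / ((t - x)\<^sup>2 + y\<^sup>2)) - y * (y / ((t - x)\<^sup>2 + y\<^sup>2)) + 1"
      using pos[of t] by (simp add: divide_simps) (simp add: power2_eq_square algebra_simps)
    from arg_cong[OF this, of "\<lambda>u. poly p t * u"] show ?thesis by (simp add: algebra_simps)
  qed
  have e2: "poly (pCons 0 p) t * (y / ((t - x)\<^sup>2 + y\<^sup>2)) =
      x * (poly p t * (y / ((t - x)\<^sup>2 + y\<^sup>2))) + y * (poly p t * ((t - x) / ((t - x)\<^sup>2 + y\<^sup>2)))" for t
  proof -
    have "t * (y / ((t - x)\<^sup>2 + y\<^sup>2)) = x * (y / ((t - x)\<^sup>2 + y\<^sup>2)) + y * ((t - x) / ((t - x)\<^sup>2 + y\<^sup>2))"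
      using pos[of t] by (simp add: divide_simps) (simp add: algebra_simps)
    from arg_cong[OF this, of "\<lambda>u. poly p t * u"] show ?thesis by (simp add: algebra_simps)
  qed
  show ?thesis
    unfolding cauchy_integral_def e1 e2
    using int kernel_integrals(1,2)[of p]
    by (simp add: complex_eq_iff del: times_divide_eq_right times_divide_eq_left)
qed

text \<open>In row 0 the inhomogeneous term \<open>L (orthopoly 0)\<close> survives. It does not
  depend on the solution \<mu>, so it cancels in the difference of two solutions.\<close>

lemma cauchy_integral_recurrence_0:
  "complex_of_real (rec_b 0) * cauchy_integral \<mu> x y (orthopoly (Suc 0))
     + complex_of_real (rec_a 0) * cauchy_integral \<mu> x y (orthopoly 0)
   = Complex x y * cauchy_integral \<mu> x y (orthopoly 0) + complex_of_real (L (orthopoly 0))"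
  using cauchy_integral_pCons[of "orthopoly 0"]
  unfolding orthopoly_recurrence_0 cauchy_integral_add cauchy_integral_smult .

text \<open>In the later rows the extra term \<open>L (orthopoly (Suc n))\<close> of
  \<open>cauchy_integral_pCons\<close> is 0.\<close>

lemma jacobi_solution_cauchy_integral:
  "jacobi_solution (\<lambda>n. complex_of_real (rec_a n)) (\<lambda>n. complex_of_real (rec_b n)) (Complex x y)
     (\<lambda>n. cauchy_integral \<mu> x y (orthopoly n))"
  unfolding jacobi_solution_def
  using cauchy_integral_pCons[of "orthopoly (Suc n)" for n]
  unfolding orthopoly_recurrence cauchy_integral_add cauchy_integral_smult L_orthopoly_Suc
  by simp

end

lemma summable_if_not_unique:
  assumes \<mu>: "moment_solution s \<mu>" and \<nu>: "moment_solution s \<nu>" and "\<mu> \<noteq> \<nu>"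
  shows "summable (\<lambda>n. (poly (orthopoly n) 0)\<^sup>2)" "summable (\<lambda>n. (second_kind n)\<^sup>2)"
proof -
  obtain x y where y: "y > 0"
    and ne: "(\<integral>t. y / ((t - x)\<^sup>2 + y\<^sup>2) \<partial>\<mu>) \<noteq> (\<integral>t. y / ((t - x)\<^sup>2 + y\<^sup>2) \<partial>\<nu>)"
    using finite_measure_eqI_Poisson[of \<mu> \<nu>] moment_solution_finite_measure[OF \<mu>]
      moment_solution_finite_measure[OF \<nu>] \<mu> \<nu> \<open>\<mu> \<noteq> \<nu>\<close>
    by (auto simp: moment_solution_def)
  let ?a = "\<lambda>n. complex_of_real (rec_a n)" and ?b = "\<lambda>n. complex_of_real (rec_b n)"
  define z where "z = Complex x y"
  define u where "u n = cauchy_integral \<mu> x y (orthopoly n)" for n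
  define v where "v n = cauchy_integral \<nu> x y (orthopoly n)" for n
  \<comment> \<open>\<open>u\<close> and \<open>d\<close> will be the two independent solutions:
    \<open>d\<close> obeys row 0 without the inhomogeneous term, \<open>u\<close> does not.\<close>
  define d where "d n = u n - v n" for n
  have ju: "jacobi_solution ?a ?b z u" and jv: "jacobi_solution ?a ?b z v"
    unfolding u_def v_def z_def
    by (rule jacobi_solution_cauchy_integral[OF \<mu> y], rule jacobi_solution_cauchy_integral[OF \<nu> y])
  have jd: "jacobi_solution ?a ?b z d"
    unfolding jacobi_solution_def
  proof
    fix n
    have "?b (Suc n) * d (Suc (Suc n)) + ?a (Suc n) * d (Suc n) + ?b n * d n =
      (?b (Suc n) * u (Suc (Suc n)) + ?a (Suc n) * u (Suc n) + ?b n * u n) -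
      (?b (Suc n) * v (Suc (Suc n)) + ?a (Suc n) * v (Suc n) + ?b n * v n)"
      by (simp add: d_def algebra_simps)
    also have "\<dots> = z * d (Suc n)"
      using ju jv by (simp add: jacobi_solution_def d_def algebra_simps)
    finally show "?b (Suc n) * d (Suc (Suc n)) + ?a (Suc n) * d (Suc n) + ?b n * d n = z * d (Suc n)" .
  qed
  have su: "summable (\<lambda>n. (norm (u n))\<^sup>2)" and sv: "summable (\<lambda>n. (norm (v n))\<^sup>2)"
    unfolding u_def v_def
    by (rule summable_cauchy_integral[OF \<mu> y], rule summable_cauchy_integral[OF \<nu> y])
  have sd: "summable (\<lambda>n. (norm (d n))\<^sup>2)"
  proof (rule summable_comparison_test'[OF summable_square_add[OF su sv]])
    show "norm ((norm (d n))\<^sup>2) \<le> (norm (u n) + norm (v n))\<^sup>2" for n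
      unfolding d_def using norm_triangle_ineq4[of "u n" "v n"] by (simp add: power_mono)
  qed
  obtain e where e: "orthopoly 0 = [:e:]" using degree_orthopoly[of 0] degree_eq_zeroE by blast
  have eL: "e * L (orthopoly 0) = 1"
    using orthonormal[of 0 0] moment_functional_smult[of s e "[:e:]"] by (simp add: e)
  \<comment> \<open>Since \<open>orthopoly 0\<close> is the constant \<open>e\<close>, the imaginary
    part at index 0 sees exactly the differing Poisson integrals.\<close>
  have "Im (d 0) = e * ((\<integral>t. y / ((t - x)\<^sup>2 + y\<^sup>2) \<partial>\<mu>) - (\<integral>t. y / ((t - x)\<^sup>2 + y\<^sup>2) \<partial>\<nu>))"
    by (simp add: d_def u_def v_def cauchy_integral_def e right_diff_distrib del: times_divide_eq_right)
  hence "d 0 \<noteq> 0" using ne eL by auto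
  have u1: "?b 0 * u (Suc 0) = z * u 0 + complex_of_real (L (orthopoly 0)) - ?a 0 * u 0"
    and v1: "?b 0 * v (Suc 0) = z * v 0 + complex_of_real (L (orthopoly 0)) - ?a 0 * v 0"
    using cauchy_integral_recurrence_0[OF \<mu> y, of x] cauchy_integral_recurrence_0[OF \<nu> y, of x]
    by (simp_all add: u_def v_def z_def eq_diff_eq)
  have "casoratian ?b u d 0 = (?b 0 * u (Suc 0)) * d 0 - u 0 * (?b 0 * u (Suc 0) - ?b 0 * v (Suc 0))"
    by (simp add: casoratian_def d_def algebra_simps)
  also have "\<dots> = complex_of_real (L (orthopoly 0)) * d 0"
    unfolding u1 v1 by (simp add: d_def algebra_simps)
  finally have W: "casoratian ?b u d 0 \<noteq> 0" using \<open>d 0 \<noteq> 0\<close> eL by auto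
  have sum_real: "summable (\<lambda>n. (f n)\<^sup>2)" if f: "jacobi_solution rec_a rec_b 0 f" for f
  proof -
    have "jacobi_solution ?a ?b 0 (\<lambda>n. complex_of_real (f n))"
      using f unfolding jacobi_solution_def
      by (metis (mono_tags, lifting) of_real_add of_real_mult of_real_0)
    from square_summable_jacobi_solution[OF ju jd this W su sd] show ?thesis by simp
  qed
  show "summable (\<lambda>n. (poly (orthopoly n) 0)\<^sup>2)" "summable (\<lambda>n. (second_kind n)\<^sup>2)"
    by (rule sum_real[OF jacobi_solution_orthopoly] sum_real[OF jacobi_solution_second_kind])+
qed

theorem moment_determinate_iff:
  "moment_determinate s \<longleftrightarrow> \<not> summable (\<lambda>n. (poly (orthopoly n) 0)\<^sup>2 + (second_kind n)\<^sup>2)"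
proof -
  let ?P = "\<lambda>n. (poly (orthopoly n) 0)\<^sup>2" and ?Q = "\<lambda>n. (second_kind n)\<^sup>2"
  have iff: "summable (\<lambda>n. ?P n + ?Q n) \<longleftrightarrow> summable ?P \<and> summable ?Q"
  proof
    assume *: "summable (\<lambda>n. ?P n + ?Q n)"
    show "summable ?P \<and> summable ?Q"
      by (intro conjI summable_comparison_test'[OF *]) auto
  qed (auto intro: summable_add)
  \<comment> \<open>Existence matters here: failure of unique existence yields two distinct
    solutions only once one solution is known.\<close>
  obtain \<rho> where \<rho>: "moment_solution s \<rho>" by (rule moment_solution_exists)
  show ?thesis
    unfolding iff using not_determinate_if_summable summable_if_not_unique[OF \<rho>] \<rho>
    unfolding moment_determinate_def by metis
qed

end

section \<open>The Krein-Langer string\<close>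

lemma suminf_ennreal_eq_top_iff:
  assumes "\<And>n. f n \<ge> 0"
  shows "(\<Sum>n. ennreal (f n)) = \<infinity> \<longleftrightarrow> \<not> summable f"
proof
  assume top: "(\<Sum>n. ennreal (f n)) = \<infinity>"
  show "\<not> summable f"
  proof
    assume "summable f"
    hence "(\<Sum>n. ennreal (f n)) = ennreal (suminf f)" using assms by (intro suminf_ennreal2)
    thus False using top by simp
  qed
next
  assume "\<not> summable f"
  thus "(\<Sum>n. ennreal (f n)) = \<infinity>"
    using summable_suminf_not_top[of f, OF assms] unfolding infinity_ennreal_def by blast
qed

context positive_hankel
begin

section \<open>The indices k(j) and the gaps between them\<close>

abbreviation kap :: "nat \<Rightarrow> nat" where "kap \<equiv> kidx s"

text \<open>Two consecutive zeros would annihilate the left side of \<open>Delta_wronskian\<close>,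
  whose right side is a positive square. Hence all gaps k(j+1) - k(j) are 1 or 2.\<close>

lemma Delta1_consecutive: "Delta1 s n = 0 \<Longrightarrow> Delta1 s (Suc n) \<noteq> 0"
proof
  assume "Delta1 s n = 0" "Delta1 s (Suc n) = 0"
  hence "(D (Suc n))\<^sup>2 = 0" using Delta_wronskian[of n] by simp
  thus False by simp
qed

lemma infinite_Delta1_nonzero: "infinite {i. Delta1 s i \<noteq> 0}"
  unfolding infinite_nat_iff_unbounded_le
proof
  fix m
  show "\<exists>n\<ge>m. n \<in> {i. Delta1 s i \<noteq> 0}"
  proof (cases "Delta1 s m = 0")
    case True
    thus ?thesis using Delta1_consecutive[of m] by (intro exI[of _ "Suc m"]) simp
  next
    case False
    thus ?thesis by (intro exI[of _ m]) simp
  qed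
qed

text \<open>The count of nonzero entries below \<open>k\<close> stays at \<open>j\<close> until the
  entry numbered \<open>j\<close>, counted from 0, is passed; the greatest such \<open>k\<close> is
  the index of that entry.\<close>

lemma kidx_eq_enumerate: "kap j = enumerate {i. Delta1 s i \<noteq> 0} j"
proof -
  let ?N = "{i. Delta1 s i \<noteq> 0}"
  let ?e = "enumerate ?N"
  note inf = infinite_Delta1_nonzero
  have mono: "strict_mono ?e" by (rule strict_mono_enumerate[OF inf])
  have "{i. i < ?e j \<and> Delta1 s i \<noteq> 0} = ?e ` {..<j}"
  proof (intro equalityI subsetI)
    fix i assume i: "i \<in> {i. i < ?e j \<and> Delta1 s i \<noteq> 0}"
    then obtain n where n: "?e n = i" using enumerate_Ex[OF inf, of i] by auto
    hence "n < j" using i strict_mono_less[OF mono, of n j] by simp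
    thus "i \<in> ?e ` {..<j}" using n by auto
  next
    fix i assume "i \<in> ?e ` {..<j}"
    thus "i \<in> {i. i < ?e j \<and> Delta1 s i \<noteq> 0}"
      using strict_mono_less[OF mono] enumerate_in_set[OF inf] by auto
  qed
  moreover have "card (?e ` {..<j}) = j"
    using strict_mono_imp_inj_on[OF mono] by (simp add: card_image inj_on_subset)
  ultimately have "card {i. i < ?e j \<and> Delta1 s i \<noteq> 0} = j" by simp
  moreover have "k \<le> ?e j" if "card {i. i < k \<and> Delta1 s i \<noteq> 0} = j" for k
  proof (rule ccontr)
    assume "\<not> k \<le> ?e j"
    hence "?e i < k" if "i \<le> j" for i
      using that strict_mono_less_eq[OF mono, of i j] by simp
    hence "?e ` {..j} \<subseteq> {i. i < k \<and> Delta1 s i \<noteq> 0}"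
      using enumerate_in_set[OF inf] by auto
    hence "card (?e ` {..j}) \<le> j"
      using that card_mono[of "{i. i < k \<and> Delta1 s i \<noteq> 0}" "?e ` {..j}"] by simp
    moreover have "card (?e ` {..j}) = Suc j"
      using strict_mono_imp_inj_on[OF mono] by (simp add: card_image inj_on_subset)
    ultimately show False by simp
  qed
  ultimately show ?thesis
    unfolding kidx_def by (rule Greatest_equality)
qed

lemma strict_mono_kidx: "strict_mono kap"
  unfolding kidx_eq_enumerate[abs_def] by (rule strict_mono_enumerate[OF infinite_Delta1_nonzero])

lemma Delta1_kidx: "Delta1 s (kap j) \<noteq> 0"
  using enumerate_in_set[OF infinite_Delta1_nonzero, of j] by (simp add: kidx_eq_enumerate)

lemma kidx_0 [simp]: "kap 0 = 0"
  unfolding kidx_eq_enumerate enumerate_0 by (rule Least_equality) (auto simp: Delta1_def)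

lemma kidx_Suc_cases:
  obtains (one) "kap (Suc j) = Suc (kap j)"
    | (two) "kap (Suc j) = Suc (Suc (kap j))" "Delta1 s (Suc (kap j)) = 0"
proof (cases "Delta1 s (Suc (kap j)) = 0")
  case False
  hence "kap (Suc j) = Suc (kap j)"
    unfolding kidx_eq_enumerate enumerate_Suc''[OF infinite_Delta1_nonzero]
    by (intro Least_equality) auto
  thus thesis by (rule one)
next
  case True
  have "kap (Suc j) = Suc (Suc (kap j))"
    unfolding kidx_eq_enumerate enumerate_Suc''[OF infinite_Delta1_nonzero]
  proof (rule Least_equality)
    let ?e = "enumerate {i. Delta1 s i \<noteq> 0} j"
    have z: "Delta1 s (Suc ?e) = 0" using True by (simp add: kidx_eq_enumerate)
    show "Suc (Suc ?e) \<in> {i. Delta1 s i \<noteq> 0} \<and> ?e < Suc (Suc ?e)"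
      using Delta1_consecutive[OF z] by simp
    fix m assume m: "m \<in> {i. Delta1 s i \<noteq> 0} \<and> ?e < m"
    hence "m \<noteq> Suc ?e" using z by auto
    thus "Suc (Suc ?e) \<le> m" using m by simp
  qed
  thus thesis using True by (rule two)
qed

section \<open>String coefficients as squared values at the origin\<close>

definition firstsq :: "nat \<Rightarrow> real" where "firstsq n = (poly (orthopoly n) 0)\<^sup>2"
definition secondsq :: "nat \<Rightarrow> real" where "secondsq n = (second_kind n)\<^sup>2"

lemma firstsq_eq: "firstsq n = (Delta1 s n)\<^sup>2 / (D n * D (Suc n))"
  by (simp add: firstsq_def poly_orthopoly_0 power_divide power_mult_distrib minus_one_power_iff)

lemma secondsq_eq: "secondsq n = (Deltam1 s n)\<^sup>2 / (D n * D (Suc n))"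
  by (simp add: secondsq_def second_kind_eq power_divide power_mult_distrib minus_one_power_iff)

lemma firstsq_nonneg [simp]: "firstsq n \<ge> 0" and secondsq_nonneg [simp]: "secondsq n \<ge> 0"
  by (simp_all add: firstsq_def secondsq_def)

lemma string_l_eq: "string_l s j = firstsq (kap j)"
  by (simp add: string_l_def firstsq_eq Delta0_int Delta0_int_minus_1)

lemma string_l_pos: "string_l s j > 0"
  unfolding string_l_eq firstsq_eq using Delta1_kidx[of j] hankel_det_pos by simp

text \<open>\<open>Delta_wronskian\<close> turns the formula for gap 1 into the one for gap 2, so a
  single difference covers both cases.\<close>

lemma string_omega_eq:
  "string_omega s j = Deltam1 s (kap j) / Delta1 s (kap j) - Deltam1 s (kap (Suc j)) / Delta1 s (kap (Suc j))"
proof (cases rule: kidx_Suc_cases[of j])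
  case one
  have nz: "Delta1 s (kap j) \<noteq> 0" "Delta1 s (Suc (kap j)) \<noteq> 0"
    using Delta1_kidx[of j] Delta1_kidx[of "Suc j"] one by auto
  have "string_omega s j = (D (Suc (kap j)))\<^sup>2 / (Delta1 s (kap j) * Delta1 s (Suc (kap j)))"
    using one by (simp add: string_omega_def Delta0_int)
  thus ?thesis
    unfolding one Delta_wronskian[symmetric] using nz by (simp add: field_simps)
qed (simp add: string_omega_def)

text \<open>Telescoping; the initial term vanishes because k(0) = 0 and \<Delta>_{-1,0} = 0.\<close>

lemma sum_string_omega:
  "(\<Sum>k\<le>n. string_omega s k) = - (Deltam1 s (kap (Suc n)) / Delta1 s (kap (Suc n)))"
proof (induction n)
  case 0
  show ?case by (simp add: string_omega_eq Deltam1_def)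
next
  case (Suc n)
  thus ?case by (simp add: string_omega_eq)
qed

lemma string_l_mult_sum_omega:
  "string_l s (Suc n) * (\<Sum>k\<le>n. string_omega s k)\<^sup>2 = secondsq (kap (Suc n))"
  using Delta1_kidx[of "Suc n"]
  by (simp add: sum_string_omega string_l_eq firstsq_eq secondsq_eq power_divide)

lemma string_upsilon_eq:
  "string_upsilon s j = (if kap (Suc j) = Suc (kap j) then 0 else secondsq (Suc (kap j)))"
proof -
  have "Delta0 s (int (kap j) + 1) = D (Suc (Suc (kap j)))"
    using Delta0_int[of s "Suc (kap j)"] by (simp add: add.commute)
  thus ?thesis
    by (cases rule: kidx_Suc_cases[of j]) (simp_all add: string_upsilon_def secondsq_eq Delta0_int)
qed

lemma string_upsilon_nonneg: "string_upsilon s j \<ge> 0"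
  by (simp add: string_upsilon_eq)

abbreviation string_term :: "nat \<Rightarrow> real" where
  "string_term n \<equiv> string_l s (Suc n) + string_l s (Suc n) * (\<Sum>k\<le>n. string_omega s k)\<^sup>2
     + string_upsilon s n"

lemma string_term_nonneg: "string_term n \<ge> 0"
  unfolding string_l_mult_sum_omega using string_l_pos[of "Suc n"] string_upsilon_nonneg[of n] by simp

text \<open>In a gap of 2 the skipped index has \<Delta>_1 = 0, so \<open>firstsq\<close> vanishes
  there and \<open>string_upsilon\<close> supplies exactly the missing
  \<open>secondsq\<close>.\<close>

lemma string_term_eq: "string_term n = (\<Sum>i\<in>{kap n<..kap (Suc n)}. firstsq i + secondsq i)"
proof (cases rule: kidx_Suc_cases[of n])
  case one
  have "{kap n<..Suc (kap n)} = {Suc (kap n)}" by auto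
  thus ?thesis
    using string_l_mult_sum_omega[of n] unfolding string_l_eq string_upsilon_eq one by simp
next
  case two
  have "{kap n<..Suc (Suc (kap n))} = {Suc (kap n), Suc (Suc (kap n))}" by auto
  moreover have "firstsq (Suc (kap n)) = 0" using two by (simp add: firstsq_eq)
  ultimately show ?thesis
    using string_l_mult_sum_omega[of n] unfolding string_l_eq string_upsilon_eq two by simp
qed

lemma sum_string_term: "(\<Sum>n<m. string_term n) = (\<Sum>i\<in>{0<..kap m}. firstsq i + secondsq i)"
proof (induction m)
  case (Suc m)
  have "kap m \<le> kap (Suc m)" using strict_monoD[OF strict_mono_kidx, of m "Suc m"] by simp
  hence "{0<..kap (Suc m)} = {0<..kap m} \<union> {kap m<..kap (Suc m)}" by auto
  hence "(\<Sum>i\<in>{0<..kap (Suc m)}. firstsq i + secondsq i) =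
      (\<Sum>i\<in>{0<..kap m}. firstsq i + secondsq i) + (\<Sum>i\<in>{kap m<..kap (Suc m)}. firstsq i + secondsq i)"
    by (simp add: sum.union_disjoint ivl_disj_int)
  thus ?case using Suc string_term_eq[of m] by (simp only: sum.lessThan_Suc)
qed simp

text \<open>Partial sums up to k(m) differ only by the term at index 0, and m \<le> k(m) makes them
  exhaust the whole series.\<close>

lemma summable_string_term_iff:
  "summable string_term \<longleftrightarrow> summable (\<lambda>n. firstsq n + secondsq n)"
proof
  assume *: "summable string_term"
  have "(\<Sum>i<m. firstsq i + secondsq i) \<le> firstsq 0 + secondsq 0 + suminf string_term" for m
  proof -
    have "m \<le> kap m" by (rule seq_suble[OF strict_mono_kidx])
    hence "(\<Sum>i<m. firstsq i + secondsq i) \<le> (\<Sum>i\<in>insert 0 {0<..kap m}. firstsq i + secondsq i)"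
      by (intro sum_mono2) auto
    also have "\<dots> = firstsq 0 + secondsq 0 + (\<Sum>n<m. string_term n)"
      by (simp only: sum_string_term) simp
    also have "(\<Sum>n<m. string_term n) \<le> suminf string_term"
      by (rule sum_le_suminf[OF *]) (auto intro: string_term_nonneg)
    finally show ?thesis by simp
  qed
  thus "summable (\<lambda>n. firstsq n + secondsq n)"
    by (intro summableI_nonneg_bounded) auto
next
  assume *: "summable (\<lambda>n. firstsq n + secondsq n)"
  have "(\<Sum>n<m. string_term n) \<le> (\<Sum>n. firstsq n + secondsq n)" for m
    unfolding sum_string_term by (rule sum_le_suminf[OF *]) auto
  thus "summable string_term"
    by (intro summableI_nonneg_bounded string_term_nonneg)
qed

section \<open>Positions on the string and the integral of the squared w\<close>

lemma string_x_Suc: "string_x s (Suc j) = string_x s j + string_l s (Suc j)"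
  by (simp add: string_x_def)

lemma strict_mono_string_x: "strict_mono (string_x s)"
  by (rule strict_mono_Suc_iff[THEN iffD2]) (simp add: string_x_Suc string_l_pos)

lemma string_x_pos: "string_x s j > 0"
  unfolding string_x_def by (rule sum_pos) (auto simp: string_l_pos)

lemma ennreal_string_x: "ennreal (string_x s j) = (\<Sum>i<Suc j. ennreal (string_l s i))"
  unfolding string_x_def lessThan_Suc_atMost
  by (rule sum_ennreal[symmetric]) (simp add: string_l_pos less_imp_le)

text \<open>Strict because a further interval of positive length follows; so every mass point lies
  in [0,L).\<close>

lemma string_x_less_L: "ennreal (string_x s j) < string_L s"
proof -
  have "ennreal (string_x s j) < ennreal (string_x s (Suc j))"
    using string_x_pos[of j] string_l_pos[of "Suc j"] by (intro ennreal_lessI) (auto simp: string_x_Suc)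
  also have "\<dots> \<le> string_L s"
    unfolding ennreal_string_x string_L_def by (rule sum_le_suminf) auto
  finally show ?thesis .
qed

lemma string_L_le:
  assumes "\<And>j. string_x s j < x"
  shows "string_L s \<le> ennreal x"
  unfolding string_L_def
proof (rule suminf_le_const)
  fix n
  have "(\<Sum>i<n. ennreal (string_l s i)) \<le> (\<Sum>i<Suc n. ennreal (string_l s i))"
    by (rule sum_mono2) auto
  also have "\<dots> \<le> ennreal x"
    unfolding ennreal_string_x[symmetric] using assms[of n] by (intro ennreal_leI) simp
  finally show "(\<Sum>i<n. ennreal (string_l s i)) \<le> ennreal x" .
qed simp

text \<open>The interval is open on the left and closed on the right because w(x) counts the masses
  in [0,x), excluding one located at x.\<close>

lemma string_w_eq:
  assumes "string_x s n < x" "x \<le> string_x s (Suc n)"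
  shows "string_w s x = (\<Sum>k\<le>n. string_omega s k)"
proof -
  have "{j. 0 \<le> string_x s j \<and> string_x s j < x} = {..n}"
  proof (intro equalityI subsetI)
    fix j assume "j \<in> {j. 0 \<le> string_x s j \<and> string_x s j < x}"
    hence "string_x s j < string_x s (Suc n)" using assms by simp
    thus "j \<in> {..n}" by (simp add: strict_mono_less[OF strict_mono_string_x])
  next
    fix j assume "j \<in> {..n}"
    hence "string_x s j \<le> string_x s n" by (simp add: strict_mono_less_eq[OF strict_mono_string_x])
    thus "j \<in> {j. 0 \<le> string_x s j \<and> string_x s j < x}"
      using assms string_x_pos[of j] by simp
  qed
  thus ?thesis by (simp add: string_w_def)
qed

text \<open>Outside the intervals nothing is lost: up to x_0 no mass has been met and w = 0, while a
  point beyond all x_j is at least L.\<close>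

lemma string_w_square_decomposition:
  "indicator {x. 0 \<le> x \<and> ennreal x < string_L s} x * ennreal ((string_w s x)\<^sup>2) =
     (\<Sum>n. ennreal ((\<Sum>k\<le>n. string_omega s k)\<^sup>2) * indicator {string_x s n<..string_x s (Suc n)} x)"
  (is "?lhs = ?rhs")
proof (cases "\<exists>n. string_x s n < x \<and> x \<le> string_x s (Suc n)")
  case True
  then obtain n where n: "string_x s n < x" "x \<le> string_x s (Suc n)" by blast
  have other: "\<not> (string_x s m < x \<and> x \<le> string_x s (Suc m))" if "m \<noteq> n" for m
  proof (cases "m < n")
    case True
    hence "string_x s (Suc m) \<le> string_x s n" by (simp add: strict_mono_less_eq[OF strict_mono_string_x])
    thus ?thesis using n by simp
  next
    case False
    hence "string_x s (Suc n) \<le> string_x s m"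
      using that by (simp add: strict_mono_less_eq[OF strict_mono_string_x])
    thus ?thesis using n by simp
  qed
  have "0 \<le> x" using n string_x_pos[of n] by simp
  moreover have "ennreal x < string_L s"
    using ennreal_leI[OF n(2)] string_x_less_L by (rule le_less_trans)
  ultimately have "?lhs = ennreal ((\<Sum>k\<le>n. string_omega s k)\<^sup>2)"
    by (simp add: string_w_eq[OF n])
  also have "\<dots> = ?rhs"
    by (subst suminf_finite[of "{n}"]) (use other n in auto)
  finally show ?thesis .
next
  case False
  have "?lhs = 0"
  proof (cases "x \<le> string_x s 0")
    case True
    have *: "{j. 0 \<le> string_x s j \<and> string_x s j < x} = {}"
    proof -
      have "string_x s 0 \<le> string_x s j" for j
        by (simp add: strict_mono_less_eq[OF strict_mono_string_x])
      thus ?thesis using True by (auto simp: not_less intro: order_trans)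
    qed
    show ?thesis unfolding string_w_def * by simp
  next
    case x0: False
    \<comment> \<open>Lying in none of the intervals pushes \<open>x\<close> past each next mass
      point in turn.\<close>
    have "string_x s j < x" for j
      by (induction j) (use x0 False in \<open>auto simp: not_le\<close>)
    hence "string_L s \<le> ennreal x" by (rule string_L_le)
    thus ?thesis by (auto simp: not_less split: split_indicator)
  qed
  moreover have "indicator {string_x s n<..string_x s (Suc n)} x = (0 :: ennreal)" for n
    using False by (simp add: indicator_def)
  hence "?rhs = 0" by simp
  ultimately show ?thesis by simp
qed

lemma string_w_square_integral:
  "(\<integral>\<^sup>+x. indicator {x. 0 \<le> x \<and> ennreal x < string_L s} x * ennreal ((string_w s x)\<^sup>2) \<partial>lborel) =
     (\<Sum>n. ennreal (string_l s (Suc n) * (\<Sum>k\<le>n. string_omega s k)\<^sup>2))"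
proof -
  have *: "(\<integral>\<^sup>+x. ennreal ((\<Sum>k\<le>n. string_omega s k)\<^sup>2) * indicator {string_x s n<..string_x s (Suc n)} x \<partial>lborel)
      = ennreal (string_l s (Suc n) * (\<Sum>k\<le>n. string_omega s k)\<^sup>2)" for n
  proof -
    have "(\<integral>\<^sup>+x. ennreal ((\<Sum>k\<le>n. string_omega s k)\<^sup>2) * indicator {string_x s n<..string_x s (Suc n)} x \<partial>lborel)
        = ennreal ((\<Sum>k\<le>n. string_omega s k)\<^sup>2) * ennreal (string_l s (Suc n))"
      using string_l_pos[of "Suc n"]
      by (subst nn_integral_cmult_indicator) (simp_all add: string_x_Suc)
    also have "\<dots> = ennreal (string_l s (Suc n) * (\<Sum>k\<le>n. string_omega s k)\<^sup>2)"
      using string_l_pos[of "Suc n"] by (subst mult.commute) (simp add: ennreal_mult)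
    finally show ?thesis .
  qed
  show ?thesis
    unfolding string_w_square_decomposition
    by (subst nn_integral_suminf) (measurable, simp only: *)
qed

lemma string_upsilon_mass_eq: "string_upsilon_mass s = (\<Sum>j. ennreal (string_upsilon s j))"
  unfolding string_upsilon_mass_def
  by (simp only: string_x_less_L less_imp_le[OF string_x_pos] simp_thms if_True)

text \<open>All contributions are nonnegative, so divergence of either total means divergence of one
  of three series; the extra length \<open>string_l s 0\<close> is a single finite term.\<close>

lemma string_singular_iff: "string_singular s \<longleftrightarrow> \<not> summable string_term"
proof -
  let ?w = "\<lambda>n. string_l s (Suc n) * (\<Sum>k\<le>n. string_omega s k)\<^sup>2"
  have l0: "string_l s n \<ge> 0" for n using string_l_pos[of n] by simp
  have w0: "?w n \<ge> 0" for n using l0 by simp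
  have "string_singular s \<longleftrightarrow> \<not> (summable (string_l s) \<and> summable ?w \<and> summable (string_upsilon s))"
    unfolding string_singular_def string_w_square_integral string_upsilon_mass_eq
    unfolding string_L_def infinity_ennreal_def ennreal_add_eq_top
      suminf_ennreal_eq_top_iff[of "string_l s", OF l0, unfolded infinity_ennreal_def]
      suminf_ennreal_eq_top_iff[of ?w, OF w0, unfolded infinity_ennreal_def]
      suminf_ennreal_eq_top_iff[of "string_upsilon s", OF string_upsilon_nonneg, unfolded infinity_ennreal_def]
    by blast
  moreover have "summable string_term \<longleftrightarrow> summable (\<lambda>n. string_l s (Suc n)) \<and> summable ?w \<and> summable (string_upsilon s)"
  proof
    assume *: "summable string_term"
    show "summable (\<lambda>n. string_l s (Suc n)) \<and> summable ?w \<and> summable (string_upsilon s)"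
    proof (intro conjI; rule summable_comparison_test'[OF *])
      fix n
      note nonneg = l0[of "Suc n"] w0[of n] string_upsilon_nonneg[of n]
      show "norm (string_l s (Suc n)) \<le> string_term n"
        using nonneg unfolding real_norm_def by linarith
      show "norm (?w n) \<le> string_term n"
        using nonneg unfolding real_norm_def by linarith
      show "norm (string_upsilon s n) \<le> string_term n"
        using nonneg unfolding real_norm_def by linarith
    qed
  next
    assume "summable (\<lambda>n. string_l s (Suc n)) \<and> summable ?w \<and> summable (string_upsilon s)"
    thus "summable string_term" by (intro summable_add) blast+
  qed
  ultimately show ?thesis by (simp only: summable_Suc_iff[of "string_l s"])
qed

end

theorem theorem5p6:
  fixes s :: "nat \<Rightarrow> real"
  assumes "strictly_positive s"
  shows "(moment_determinate s \<longleftrightarrow> string_singular s)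
       \<and> (string_singular s \<longleftrightarrow>
          (\<Sum>n. ennreal (string_l s (Suc n)
                         + string_l s (Suc n) * (\<Sum>k\<le>n. string_omega s k)\<^sup>2
                         + string_upsilon s n)) = \<infinity>)"
proof -
  interpret positive_hankel s by (rule strictly_positive_imp_positive_hankel[OF assms])
  \<comment> \<open>Both equivalences pass through the divergence of
    \<open>string_term\<close>.\<close>
  have "moment_determinate s \<longleftrightarrow> \<not> summable string_term"
    unfolding moment_determinate_iff summable_string_term_iff firstsq_def secondsq_def ..
  thus ?thesis
    using string_singular_iff suminf_ennreal_eq_top_iff[of string_term, OF string_term_nonneg] by blast
qed

end
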